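(* There exists $n_0$ such that for all $n\ge n_0$ the following holds. There is a nonempty set $A\subseteq\left\{\left\lfloor\frac12\left(n+\sqrt{3n-4}\right)\right\rfloor,\left\lceil\frac12\left(n+\sqrt{3n-4}\right)\right\rceil\right\}$ such that, for all $a\in A$, every red-blue $K_n$ has at most \[3\left(a\binom{n-a}{3}+(n-a)\binom{a}{3}\right)=\frac{1}{16}n^4+O(n^3)\] $RRBB$-cycles. Moreover, this is achieved if and only if the edges of one colour form a complete bipartite graph $K_{a,n-a}$ on all $n$ vertices for some $a\in A$.
   Context: A red-blue $K_n$ is a complete graph on $n$ vertices each of whose edges is coloured red or blue. An $RRBB$-cycle is a $4$-cycle (counted as a subgraph) in which exactly two edges are red and these two red edges share a vertex (so the colours in cyclic order are red, red, blue, blue). *)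

theory Defs
  imports Complex_Main "HOL-Library.Landau_Symbols"
begin

datatype colour = Red | Blue

definition complete_edges :: "'a set \<Rightarrow> 'a set set" where
  "complete_edges V = {e. e \<subseteq> V \<and> card e = 2}"

text \<open>A red-blue complete graph on a finite vertex set \<open>V\<close> is given by a function \<open>c\<close> on
  two-element sets; only the values of \<open>c\<close> on \<open>complete_edges V\<close> are ever used.\<close>

definition colour_class :: "'a set \<Rightarrow> ('a set \<Rightarrow> colour) \<Rightarrow> colour \<Rightarrow> 'a set set" where
  "colour_class V c k = {e \<in> complete_edges V. c e = k}"

text \<open>A 4-cycle, counted as a subgraph, is identified with its set of edges.\<close>

definition four_cycles :: "'a set \<Rightarrow> 'a set set set" where
  "four_cycles V =
     {{{w, x}, {x, y}, {y, z}, {z, w}} | w x y z. {w, x, y, z} \<subseteq> V \<and> distinct [w, x, y, z]}"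

definition RRBB_cycles :: "'a set \<Rightarrow> ('a set \<Rightarrow> colour) \<Rightarrow> 'a set set set" where
  "RRBB_cycles V c =
     {C \<in> four_cycles V. \<exists>e f. e \<noteq> f \<and> {g \<in> C. c g = Red} = {e, f} \<and> e \<inter> f \<noteq> {}}"

definition is_complete_bipartite :: "'a set \<Rightarrow> 'a set set \<Rightarrow> nat \<Rightarrow> nat \<Rightarrow> bool" where
  "is_complete_bipartite V E a b \<longleftrightarrow>
     (\<exists>X Y. X \<union> Y = V \<and> X \<inter> Y = {} \<and> card X = a \<and> card Y = b \<and>
            E = {{x, y} | x y. x \<in> X \<and> y \<in> Y})"

definition RRBB_bound :: "nat \<Rightarrow> nat \<Rightarrow> nat" where
  "RRBB_bound n a = 3 * (a * ((n - a) choose 3) + (n - a) * (a choose 3))"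

end

theory Submission imports Defs begin

text \<open>
  Encode the colouring by \<open>s u v = 1\<close> (red) or \<open>-1\<close> (blue), with \<open>s u u = 0\<close>. An RRBB-cycle is an
  ordered pair \<open>(u, w)\<close> together with a pair of common neighbours joined to \<open>u\<close> by red and to \<open>w\<close> by blue
  edges. Expanding in terms of \<open>s\<close> gives, with \<open>D u = (\<Sum>v. s u v)\<close>,
  \<open>32 N = 2 n (n - 1)\<^sup>2 (n - 4) + 8 (\<Sum>u. (D u)\<^sup>2) - 2 (\<Sum>u. D u)\<^sup>2 - 2 q\<close>, where \<open>q\<close> is the number of
  ordered \<open>4\<close>-cycles whose product of signs is \<open>-1\<close>. The degree terms are \<open>O(n\<^sup>3)\<close>, so for a good
  colouring \<open>q = O(n\<^sup>3)\<close>; averaging yields an edge \<open>uv\<close> lying in only \<open>O(n)\<close> negative cycles, and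
  this forces \<open>s u v = e x(u) x(v)\<close>, with signs \<open>e\<close>, \<open>x\<close>, for all but \<open>O(n)\<close> pairs. Choose \<open>x\<close> with as
  few exceptions (flips) as possible. Then every vertex is in at most \<open>(n - 1) / 2\<close> flips, each flip
  creates about \<open>n\<^sup>2 / 4\<close> negative cycles, but improves the degree terms only by \<open>o(n\<^sup>2)\<close>; so an optimal
  colouring has no flip, and one of its colour classes is complete bipartite. For parts of sizes \<open>a\<close> and
  \<open>n - a\<close> the count is a concave quadratic in \<open>(2a - n)\<^sup>2\<close> with vertex at \<open>3n - 4\<close>.
\<close>

section \<open>Signed complete graphs\<close>

locale signed_complete_graph =
  fixes V :: "'a set" and s :: "'a \<Rightarrow> 'a \<Rightarrow> int"
  assumes finite_V: "finite V"
    and s_sym: "s u v = s v u"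
    and s_diag [simp]: "s u u = 0"
    and s_sign: "u \<in> V \<Longrightarrow> v \<in> V \<Longrightarrow> u \<noteq> v \<Longrightarrow> s u v = 1 \<or> s u v = -1"
begin

abbreviation n :: int where "n \<equiv> int (card V)"

section \<open>Degrees, codegrees and negative 4-cycles\<close>

definition deg :: "'a \<Rightarrow> int" where "deg u = (\<Sum>v\<in>V. s u v)"

definition codeg :: "'a \<Rightarrow> 'a \<Rightarrow> int" where "codeg u w = (\<Sum>v\<in>V. s u v * s w v)"

text \<open>Degenerate closed walks never count: equal consecutive vertices give product 0, and
  \<open>u = w\<close> or \<open>v = z\<close> gives a product of squares.\<close>

definition neg :: "'a \<Rightarrow> 'a \<Rightarrow> 'a \<Rightarrow> 'a \<Rightarrow> int" where
  "neg u v w z = of_bool (s u v * s v w * s w z * s z u = -1)"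

definition negs :: int where
  "negs = (\<Sum>u\<in>V. \<Sum>v\<in>V. \<Sum>w\<in>V. \<Sum>z\<in>V. neg u v w z)"

text \<open>What remains of 32 times the number of RRBB-cycles once the colour-independent term
  \<open>2 * n * (n - 1)\<^sup>2 * (n - 4)\<close> is removed.\<close>

definition excess :: int where
  "excess = 8 * (\<Sum>u\<in>V. (deg u)\<^sup>2) - 2 * (\<Sum>u\<in>V. deg u)\<^sup>2 - 2 * negs"

lemma s_cases: "u \<in> V \<Longrightarrow> v \<in> V \<Longrightarrow> s u v = 0 \<and> u = v \<or> s u v = 1 \<and> u \<noteq> v \<or> s u v = -1 \<and> u \<noteq> v"
  using s_sign[of u v] by (cases "u = v") auto

lemma s_sq: "u \<in> V \<Longrightarrow> v \<in> V \<Longrightarrow> (s u v)\<^sup>2 = of_bool (u \<noteq> v)"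
  using s_cases[of u v] by auto

lemma cycle_sign:
  assumes "u \<in> V" "v \<in> V" "w \<in> V" "z \<in> V"
  shows "(s u v * s w v) * (s u z * s w z) =
    of_bool (v \<noteq> u \<and> v \<noteq> w) * of_bool (z \<noteq> u \<and> z \<noteq> w) - 2 * neg u v w z"
proof -
  have sy: "s v w = s w v" "s z u = s u z" by (rule s_sym)+
  show ?thesis
    using s_cases[of u v] s_cases[of w v] s_cases[of u z] s_cases[of w z] assms
    unfolding neg_def sy by auto
qed

text \<open>The case \<open>u = w\<close> is included, with value \<open>n - 1\<close>. Later sums
  over vertices other than \<open>u\<close> write the condition as
  \<open>v \<noteq> u \<and> v \<noteq> u\<close> to match this form.\<close>

lemma sum_of_bool_neq: "u \<in> V \<Longrightarrow> w \<in> V \<Longrightarrow>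
    (\<Sum>v\<in>V. of_bool (v \<noteq> u \<and> v \<noteq> w) :: int) = n - 2 + of_bool (u = w)"
proof -
  assume a: "u \<in> V" "w \<in> V"
  have "(\<Sum>v\<in>V. of_bool (v \<noteq> u \<and> v \<noteq> w) :: int) =
     (\<Sum>v\<in>V. 1 - of_bool (v = u) - of_bool (v = w) + of_bool (u = w) * of_bool (v = u))"
    by (rule sum.cong) auto
  also have "\<dots> = n - 2 + of_bool (u = w)"
    using a finite_V by (simp add: sum.distrib sum_subtractf sum.delta' of_bool_def if_distrib[of "\<lambda>x. _ * x"] flip: sum_distrib_left cong: if_cong)
  finally show ?thesis .
qed

text \<open>Expanding the square of a codegree gives signed closed 4-walks; each negative one lowers
  the value of the all-positive case by 2.\<close>

lemma sum_codeg_sq: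
  "(\<Sum>u\<in>V. \<Sum>w\<in>V. (codeg u w)\<^sup>2) = n * (n - 1) * (n - 2)\<^sup>2 + n * (n - 1)\<^sup>2 - 2 * negs"
proof -
  \<comment> \<open>The term \<open>2 * n - 3\<close> is
    \<open>(n - 1)\<^sup>2 - (n - 2)\<^sup>2\<close>, the correction for
    \<open>u = w\<close>.\<close>
  have *: "(codeg u w)\<^sup>2 = (n - 2)\<^sup>2 + of_bool (w = u) * (2 * n - 3) - 2 * (\<Sum>v\<in>V. \<Sum>z\<in>V. neg u v w z)"
    if "u \<in> V" "w \<in> V" for u w
  proof -
    have "(codeg u w)\<^sup>2 = (\<Sum>v\<in>V. \<Sum>z\<in>V. (s u v * s w v) * (s u z * s w z))"
      by (simp add: codeg_def power2_eq_square sum_product)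
    also have "\<dots> = (\<Sum>v\<in>V. \<Sum>z\<in>V. of_bool (v \<noteq> u \<and> v \<noteq> w) * of_bool (z \<noteq> u \<and> z \<noteq> w) - 2 * neg u v w z)"
      by (intro sum.cong refl cycle_sign that)
    also have "\<dots> = (\<Sum>v\<in>V. of_bool (v \<noteq> u \<and> v \<noteq> w)) * (\<Sum>v\<in>V. of_bool (v \<noteq> u \<and> v \<noteq> w))
        - 2 * (\<Sum>v\<in>V. \<Sum>z\<in>V. neg u v w z)"
      unfolding sum_product by (simp only: sum_subtractf sum_distrib_left)
    also have "\<dots> = (n - 2)\<^sup>2 + of_bool (w = u) * (2 * n - 3) - 2 * (\<Sum>v\<in>V. \<Sum>z\<in>V. neg u v w z)"
      unfolding sum_of_bool_neq[OF that] by (auto simp: power2_eq_square algebra_simps)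
    finally show ?thesis .
  qed
  have "(\<Sum>u\<in>V. \<Sum>w\<in>V. (codeg u w)\<^sup>2) =
     (\<Sum>u\<in>V. \<Sum>w\<in>V. (n - 2)\<^sup>2 + of_bool (w = u) * (2 * n - 3) - 2 * (\<Sum>v\<in>V. \<Sum>z\<in>V. neg u v w z))"
    by (intro sum.cong refl *)
  also have "\<dots> = (\<Sum>u\<in>V. n * (n - 2)\<^sup>2 + (2 * n - 3) - 2 * (\<Sum>w\<in>V. \<Sum>v\<in>V. \<Sum>z\<in>V. neg u v w z))"
  proof (rule sum.cong[OF refl])
    fix u assume "u \<in> V"
    then have "(\<Sum>w\<in>V. of_bool (w = u) * (2 * n - 3)) = 2 * n - 3"
      using finite_V by (simp flip: sum_distrib_right)
    then show "(\<Sum>w\<in>V. (n - 2)\<^sup>2 + of_bool (w = u) * (2 * n - 3) - 2 * (\<Sum>v\<in>V. \<Sum>z\<in>V. neg u v w z)) =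
      n * (n - 2)\<^sup>2 + (2 * n - 3) - 2 * (\<Sum>w\<in>V. \<Sum>v\<in>V. \<Sum>z\<in>V. neg u v w z)"
      by (simp add: sum.distrib sum_subtractf flip: sum_distrib_left)
  qed
  also have "\<dots> = n * (n * (n - 2)\<^sup>2 + (2 * n - 3)) - 2 * (\<Sum>u\<in>V. \<Sum>w\<in>V. \<Sum>v\<in>V. \<Sum>z\<in>V. neg u v w z)"
    by (simp add: sum_subtractf flip: sum_distrib_left)
  also have "(\<Sum>u\<in>V. \<Sum>w\<in>V. \<Sum>v\<in>V. \<Sum>z\<in>V. neg u v w z) = negs"
    unfolding negs_def by (rule sum.cong[OF refl]) (rule sum.swap)
  finally show ?thesis
    by (simp add: power2_eq_square algebra_simps)
qed

text \<open>Signed paths of length two are counted by their ends and by their middle vertex.\<close>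

lemma sum_codeg: "(\<Sum>u\<in>V. \<Sum>w\<in>V. codeg u w) = (\<Sum>u\<in>V. (deg u)\<^sup>2)"
proof -
  have "(\<Sum>u\<in>V. \<Sum>w\<in>V. codeg u w) = (\<Sum>u\<in>V. \<Sum>v\<in>V. \<Sum>w\<in>V. s u v * s w v)"
    unfolding codeg_def by (rule sum.cong[OF refl]) (rule sum.swap)
  also have "\<dots> = (\<Sum>v\<in>V. \<Sum>u\<in>V. \<Sum>w\<in>V. s u v * s w v)" by (rule sum.swap)
  also have "\<dots> = (\<Sum>v\<in>V. (deg v)\<^sup>2)"
    unfolding deg_def power2_eq_square sum_product by (simp only: s_sym)
  finally show ?thesis .
qed

lemma codeg_sym: "codeg u w = codeg w u"
  by (simp add: codeg_def mult.commute)

lemma codeg_self: "u \<in> V \<Longrightarrow> codeg u u = n - 1"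
proof -
  assume u: "u \<in> V"
  have "codeg u u = (\<Sum>v\<in>V. of_bool (v \<noteq> u \<and> v \<noteq> u))"
    unfolding codeg_def by (rule sum.cong) (use s_sq[OF u] in \<open>auto simp: power2_eq_square\<close>)
  then show ?thesis using sum_of_bool_neq[OF u u] by simp
qed

text \<open>The terms that are antisymmetric in \<open>u\<close> and \<open>w\<close> cancel in the double sum.\<close>

lemma sum_pairs_eq_excess:
  fixes p :: "'a \<Rightarrow> 'a \<Rightarrow> int"
  assumes p: "\<And>u w. u \<in> V \<Longrightarrow> w \<in> V \<Longrightarrow> u \<noteq> w \<Longrightarrow> 4 * p u w = n - 2 - codeg u w + deg u - deg w"
  shows "16 * (\<Sum>u\<in>V. \<Sum>w\<in>V - {u}. p u w * (p u w - 1)) = 2 * n * (n - 1)\<^sup>2 * (n - 4) + excess"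
proof -
  \<comment> \<open>With \<open>4 * p\<close> inserted, \<open>16 * p * (p - 1)\<close> is
    \<open>(4 * p)\<^sup>2 - 4 * (4 * p)\<close>. The part \<open>e\<close> is symmetric in
    \<open>u\<close> and \<open>w\<close>, while \<open>h\<close> carries the terms that
    cancel.\<close>
  define g where "g u w = (n - 2 - codeg u w + deg u - deg w)\<^sup>2 - 4 * (n - 2 - codeg u w + deg u - deg w)" for u w
  define h where "h u w = (2 * (n - 2 - codeg u w) - 4) * deg u" for u w
  define e where "e u w = (n - 2) * (n - 6) - 2 * (n - 4) * codeg u w + (codeg u w)\<^sup>2 + (deg u)\<^sup>2 + (deg w)\<^sup>2 - 2 * (deg u * deg w)" for u w
  have g: "g u w = e u w + (h u w - h w u)" for u w
    unfolding g_def h_def e_def codeg_sym[of w u] by (simp add: power2_eq_square algebra_simps)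
  have hh: "(\<Sum>u\<in>V. \<Sum>w\<in>V. h w u) = (\<Sum>u\<in>V. \<Sum>w\<in>V. h u w)" by (rule sum.swap)
  have "16 * (\<Sum>u\<in>V. \<Sum>w\<in>V - {u}. p u w * (p u w - 1)) = (\<Sum>u\<in>V. \<Sum>w\<in>V - {u}. g u w)"
    unfolding sum_distrib_left
  proof (intro sum.cong refl)
    fix u w assume "u \<in> V" "w \<in> V - {u}"
    then have eq: "n - 2 - codeg u w + deg u - deg w = 4 * p u w" using p by auto
    then show "16 * (p u w * (p u w - 1)) = g u w"
      unfolding g_def eq by (simp add: power2_eq_square algebra_simps)
  qed
  \<comment> \<open>On the diagonal \<open>codeg u u = n - 1\<close>, so \<open>g u u\<close> is 1 +
    4 = 5.\<close>
  also have "\<dots> = (\<Sum>u\<in>V. (\<Sum>w\<in>V. g u w) - 5)"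
    by (rule sum.cong[OF refl]) (simp add: sum_diff1 finite_V g_def codeg_self)
  also have "\<dots> = (\<Sum>u\<in>V. \<Sum>w\<in>V. e u w) - 5 * n"
    unfolding g by (simp add: sum_subtractf sum.distrib hh)
  also have "(\<Sum>u\<in>V. \<Sum>w\<in>V. e u w) = n * n * ((n - 2) * (n - 6))
     - 2 * (n - 4) * (\<Sum>u\<in>V. \<Sum>w\<in>V. codeg u w) + (\<Sum>u\<in>V. \<Sum>w\<in>V. (codeg u w)\<^sup>2)
     + 2 * n * (\<Sum>u\<in>V. (deg u)\<^sup>2) - 2 * (\<Sum>u\<in>V. deg u)\<^sup>2"
    unfolding e_def
    by (simp add: sum.distrib sum_subtractf sum_product power2_eq_square flip: sum_distrib_left)
  finally show ?thesis
    unfolding sum_codeg sum_codeg_sq excess_def by (simp add: power2_eq_square algebra_simps)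
qed

section \<open>Approximation by a rank-one sign pattern\<close>

text \<open>The pattern \<open>e * x u * x v\<close> describes two cliques in one colour joined
  completely in the other. Deviations are recorded for ordered pairs, so \<open>flips\<close> counts
  every wrong edge twice.\<close>

definition flip :: "int \<Rightarrow> ('a \<Rightarrow> int) \<Rightarrow> 'a \<Rightarrow> 'a \<Rightarrow> int" where
  "flip e x u v = of_bool (u \<noteq> v \<and> s u v \<noteq> e * x u * x v)"

definition flips :: "int \<Rightarrow> ('a \<Rightarrow> int) \<Rightarrow> int" where
  "flips e x = (\<Sum>u\<in>V. \<Sum>v\<in>V. flip e x u v)"

lemma flips_nonneg: "0 \<le> flips e x"
  unfolding flips_def flip_def by (intro sum_nonneg) simp

text \<open>By averaging: if every ordered pair of distinct vertices exceeded \<open>5 * n\<close>,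
  the total would be at least 5n(n - 1)n, which is more than 4n^3 once n > 5.\<close>

lemma exists_pair_in_few_neg:
  assumes "n \<ge> 10" "negs \<le> 4 * n ^ 3"
  obtains u v where "u \<in> V" "v \<in> V" "u \<noteq> v" "(\<Sum>w\<in>V. \<Sum>z\<in>V. neg u v w z) \<le> 5 * n"
proof -
  have "\<exists>u\<in>V. \<exists>v\<in>V. u \<noteq> v \<and> (\<Sum>w\<in>V. \<Sum>z\<in>V. neg u v w z) \<le> 5 * n"
  proof (rule ccontr)
    assume c: "\<not> ?thesis"
    have "(\<Sum>u\<in>V. \<Sum>v\<in>V. of_bool (v \<noteq> u \<and> v \<noteq> u) * (5 * n)) \<le> negs"
      unfolding negs_def
    proof (intro sum_mono)
      fix u v assume "u \<in> V" "v \<in> V"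
      moreover have "0 \<le> (\<Sum>w\<in>V. \<Sum>z\<in>V. neg u v w z)"
        by (intro sum_nonneg) (simp add: neg_def)
      ultimately show "of_bool (v \<noteq> u \<and> v \<noteq> u) * (5 * n) \<le> (\<Sum>w\<in>V. \<Sum>z\<in>V. neg u v w z)"
        using c by (cases "u = v") force+
    qed
    moreover have "(\<Sum>u\<in>V. \<Sum>v\<in>V. of_bool (v \<noteq> u \<and> v \<noteq> u) * (5 * n)) = n * ((n - 1) * (5 * n))"
    proof -
      have "(\<Sum>v\<in>V. of_bool (v \<noteq> u \<and> v \<noteq> u) * (5 * n)) = (n - 1) * (5 * n)" if "u \<in> V" for u
        using sum_of_bool_neq[OF that that] by (simp flip: sum_distrib_right)
      then show ?thesis by simp
    qed
    ultimately have "n * ((n - 1) * (5 * n)) \<le> 4 * n ^ 3" using assms(2) by linarith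
    then have "n\<^sup>2 * (n - 5) \<le> 0" by (simp add: power2_eq_square power3_eq_cube algebra_simps)
    moreover have "n\<^sup>2 * (n - 5) > 0" using assms(1) by simp
    ultimately show False by linarith
  qed
  then show thesis using that by blast
qed

text \<open>If \<open>u v\<close> lies in few negative cycles, most signs factor as
  \<open>a w * b z\<close>, with \<open>a\<close> read off at \<open>v\<close> and \<open>b\<close>
  at \<open>u\<close>. Symmetry of \<open>s\<close> then makes \<open>c = a * b\<close> nearly
  constant; with \<open>e\<close> its majority sign, \<open>a\<close> may be replaced by
  \<open>e * b\<close>.\<close>

lemma nearly_rank_one:
  assumes "n \<ge> 10" "negs \<le> 4 * n ^ 3"
  obtains e x where "e = 1 \<or> e = (-1::int)" "\<And>v. x v = 1 \<or> x v = (-1::int)" "flips e x \<le> 21 * n"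
proof -
  obtain u v where uv: "u \<in> V" "v \<in> V" "u \<noteq> v" and few: "(\<Sum>w\<in>V. \<Sum>z\<in>V. neg u v w z) \<le> 5 * n"
    using exists_pair_in_few_neg[OF assms] .
  \<comment> \<open>The default 1 keeps \<open>a\<close> and \<open>b\<close> sign-valued
    everywhere. At \<open>w = v\<close> and \<open>z = u\<close> it costs at most \<open>n\<close>
    exceptional pairs each, hence \<open>7 * n\<close> below.\<close>
  define a where "a w = (if w \<in> V \<and> w \<noteq> v then s u v * s v w else 1)" for w
  define b where "b z = (if z \<in> V \<and> z \<noteq> u then s z u else 1)" for z
  define ex where "ex w z = (of_bool (w \<noteq> z \<and> s w z \<noteq> a w * b z) :: int)" for w z
  define c where "c y = a y * b y" for y
  define Z where "Z = (\<Sum>y\<in>V. c y)"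
  define e where "e = (if Z \<ge> 0 then 1 else -1 :: int)"
  have a: "a w = 1 \<or> a w = -1" for w
    using uv s_sign[of u v] s_sign[of v w] by (auto simp: a_def)
  have b: "b w = 1 \<or> b w = -1" for w
    using uv s_sign[of w u] by (auto simp: b_def)
  have cc: "c w = 1 \<or> c w = -1" for w
    using a[of w] b[of w] by (auto simp: c_def)
  have ex_le: "ex w z \<le> neg u v w z + of_bool (w = v) + of_bool (z = u)" if "w \<in> V" "z \<in> V" for w z
    using that uv s_cases[of u v] s_cases[of v w] s_cases[of w z] s_cases[of z u]
    by (auto simp: ex_def neg_def a_def b_def)
  have "(\<Sum>w\<in>V. \<Sum>z\<in>V. ex w z) \<le> (\<Sum>w\<in>V. \<Sum>z\<in>V. neg u v w z + of_bool (w = v) + of_bool (z = u))"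
    by (intro sum_mono ex_le)
  also have "\<dots> = (\<Sum>w\<in>V. \<Sum>z\<in>V. neg u v w z) + n + n"
    using uv finite_V by (simp add: sum.distrib flip: sum_distrib_left)
  finally have ex: "(\<Sum>w\<in>V. \<Sum>z\<in>V. ex w z) \<le> 7 * n" using few by linarith
  \<comment> \<open>If neither order of the pair is exceptional,
    \<open>a y * b z = a z * b y\<close>, that is, \<open>c y = c z\<close>.\<close>
  have "1 - c y * c z \<le> 2 * (ex y z + ex z y)" for y z
    using a[of y] a[of z] b[of y] b[of z] s_sym[of y z] by (auto simp: c_def ex_def)
  then have "(\<Sum>y\<in>V. \<Sum>z\<in>V. 1 - c y * c z) \<le> (\<Sum>y\<in>V. \<Sum>z\<in>V. 2 * (ex y z + ex z y))"
    by (intro sum_mono)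
  also have "\<dots> = 2 * ((\<Sum>y\<in>V. \<Sum>z\<in>V. ex y z) + (\<Sum>y\<in>V. \<Sum>z\<in>V. ex z y))"
    by (simp add: sum.distrib flip: sum_distrib_left)
  also have "(\<Sum>y\<in>V. \<Sum>z\<in>V. ex z y) = (\<Sum>y\<in>V. \<Sum>z\<in>V. ex y z)" by (rule sum.swap)
  finally have "(\<Sum>y\<in>V. \<Sum>z\<in>V. 1 - c y * c z) \<le> 28 * n" using ex by simp
  moreover have "(\<Sum>y\<in>V. \<Sum>z\<in>V. 1 - c y * c z) = n * n - Z * Z"
    by (simp add: Z_def sum_subtractf sum_product)
  ultimately have ZZ: "(n - e * Z) * (n + e * Z) \<le> 28 * n"
    by (simp add: e_def algebra_simps)
  have "e * Z \<ge> 0" by (simp add: e_def)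
  \<comment> \<open>The second factor in \<open>ZZ\<close> is at least \<open>n\<close>. As
    \<open>n - e * Z\<close> is twice the number of \<open>y\<close> with
    \<open>c y \<noteq> e\<close>, at most 14 vertices disagree with the majority.\<close>
  have small: "n - e * Z \<le> 28"
  proof (rule ccontr)
    assume "\<not> n - e * Z \<le> 28"
    then have "28 * n < (n - e * Z) * n" using assms by simp
    also have "\<dots> \<le> (n - e * Z) * (n + e * Z)"
      using \<open>\<not> n - e * Z \<le> 28\<close> \<open>e * Z \<ge> 0\<close> by (intro mult_left_mono) auto
    finally show False using ZZ by linarith
  qed
  have e: "e = 1 \<or> e = -1" by (simp add: e_def)
  \<comment> \<open>When \<open>c y = e\<close>, also \<open>a y = e * b y\<close>, and flips at
    \<open>y\<close> are exactly the exceptional pairs; otherwise the last summand is 2.\<close>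
  have "2 * flip e b y z \<le> 2 * ex y z + (1 - e * c y)" for y z
    using a[of y] b[of y] b[of z] e by (elim disjE) (simp_all add: flip_def ex_def c_def)
  then have "(\<Sum>y\<in>V. \<Sum>z\<in>V. 2 * flip e b y z) \<le> (\<Sum>y\<in>V. \<Sum>z\<in>V. 2 * ex y z + (1 - e * c y))"
    by (intro sum_mono)
  also have "\<dots> = 2 * (\<Sum>y\<in>V. \<Sum>z\<in>V. ex y z) + n * (n - e * Z)"
    by (simp add: sum.distrib sum_subtractf Z_def right_diff_distrib flip: sum_distrib_left)
  also have "\<dots> \<le> 2 * (7 * n) + n * 28"
    using ex small by (intro add_mono mult_left_mono) auto
  finally have "flips e b \<le> 21 * n"
    unfolding flips_def by (simp flip: sum_distrib_left)
  with e b that show thesis by blast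
qed

text \<open>Off the diagonal, \<open>2 * flip e x u v\<close> is 1 minus
  \<open>e * (x u * x v * s u v)\<close>. Thus \<open>flips\<close> is affine in the quadratic form
  of \<open>s\<close> at \<open>x\<close>, whose change under switching a vertex is easy to
  compute.\<close>

lemma flips_conv:
  assumes "e = 1 \<or> e = -1" "\<And>v. x v = 1 \<or> x v = -1"
  shows "2 * flips e x = n * (n - 1) - e * (\<Sum>u\<in>V. \<Sum>v\<in>V. x u * x v * s u v)"
proof -
  have *: "2 * flip e x u v = of_bool (v \<noteq> u \<and> v \<noteq> u) - e * (x u * x v * s u v)" if "u \<in> V" "v \<in> V" for u v
    using s_cases[OF that] assms(1) assms(2)[of u] assms(2)[of v] by (auto simp: flip_def)
  have "2 * flips e x = (\<Sum>u\<in>V. \<Sum>v\<in>V. of_bool (v \<noteq> u \<and> v \<noteq> u) - e * (x u * x v * s u v))"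
    unfolding flips_def sum_distrib_left by (intro sum.cong refl *)
  also have "\<dots> = (\<Sum>u\<in>V. (n - 1) - e * (\<Sum>v\<in>V. x u * x v * s u v))"
    by (intro sum.cong refl, subst sum_subtractf, subst sum_of_bool_neq) (auto simp: sum_distrib_left)
  finally show ?thesis by (simp add: sum_subtractf flip: sum_distrib_left)
qed

lemma flip_degree:
  assumes "e = 1 \<or> e = -1" "\<And>v. x v = 1 \<or> x v = -1" and u: "u \<in> V"
  shows "2 * (\<Sum>v\<in>V. flip e x u v) = n - 1 - e * x u * (\<Sum>v\<in>V. x v * s u v)"
proof -
  have *: "2 * flip e x u v = of_bool (v \<noteq> u \<and> v \<noteq> u) - e * x u * (x v * s u v)" if "v \<in> V" for v
    using s_cases[OF u that] assms(1) assms(2)[of u] assms(2)[of v] by (auto simp: flip_def)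
  have "2 * (\<Sum>v\<in>V. flip e x u v) = (\<Sum>v\<in>V. of_bool (v \<noteq> u \<and> v \<noteq> u) - e * x u * (x v * s u v))"
    unfolding sum_distrib_left by (intro sum.cong refl *)
  also have "\<dots> = n - 1 - e * x u * (\<Sum>v\<in>V. x v * s u v)"
    by (subst sum_subtractf, subst sum_of_bool_neq) (use u in \<open>auto simp: sum_distrib_left\<close>)
  finally show ?thesis .
qed

text \<open>Switching the sign of a vertex replaces its flip degree \<open>k\<close> by \<open>n - 1 - k\<close>.\<close>

lemma minimal_flip_degree:
  assumes e: "e = 1 \<or> e = -1" and x: "\<And>v. x v = 1 \<or> x v = -1" and u: "u \<in> V"
    and min: "\<And>y. (\<And>v. y v = 1 \<or> y v = -1) \<Longrightarrow> flips e x \<le> flips e y"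
  shows "2 * (\<Sum>v\<in>V. flip e x u v) \<le> n - 1"
proof -
  define y where "y = x(u := - x u)"
  have y: "y v = 1 \<or> y v = -1" for v using x[of v] x[of u] by (auto simp: y_def)
  \<comment> \<open>Only terms with exactly one index equal to \<open>u\<close> change sign; the
    overlap \<open>a = b = u\<close> of the two corrections vanishes since
    \<open>s u u = 0\<close>.\<close>
  have "(\<Sum>a\<in>V. \<Sum>b\<in>V. y a * y b * s a b) =
    (\<Sum>a\<in>V. \<Sum>b\<in>V. x a * x b * s a b - 2 * (of_bool (a = u) * (x u * (x b * s u b)))
       - 2 * (of_bool (b = u) * (x u * (x a * s u a))))"
    by (intro sum.cong refl) (auto simp: y_def s_sym[of u])
  also have "\<dots> = (\<Sum>a\<in>V. \<Sum>b\<in>V. x a * x b * s a b)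
     - 2 * (\<Sum>a\<in>V. of_bool (a = u) * (x u * (\<Sum>b\<in>V. x b * s u b)))
     - 2 * (\<Sum>a\<in>V. (\<Sum>b\<in>V. of_bool (b = u)) * (x u * (x a * s u a)))"
    by (simp only: sum_subtractf sum_distrib_left sum_distrib_right)
  also have "\<dots> = (\<Sum>a\<in>V. \<Sum>b\<in>V. x a * x b * s a b) - 4 * (x u * (\<Sum>b\<in>V. x b * s u b))"
    using u finite_V by (simp flip: sum_distrib_left sum_distrib_right)
  finally have eq: "(\<Sum>a\<in>V. \<Sum>b\<in>V. y a * y b * s a b) =
    (\<Sum>a\<in>V. \<Sum>b\<in>V. x a * x b * s a b) - 4 * (x u * (\<Sum>b\<in>V. x b * s u b))" .
  have "2 * flips e y = 2 * flips e x + 4 * (e * x u * (\<Sum>b\<in>V. x b * s u b))"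
    unfolding flips_conv[of e x, OF e x] flips_conv[of e y, OF e y] eq by (simp add: algebra_simps)
  then have "e * x u * (\<Sum>b\<in>V. x b * s u b) \<ge> 0" using min[of y, OF y] by linarith
  then show ?thesis using flip_degree[of e x u, OF e x u] by linarith
qed

text \<open>Each flipped edge lies in many \<open>4\<close>-cycles in which it is the only flipped edge.\<close>

lemma negs_ge:
  assumes e: "e = 1 \<or> e = -1" and x: "\<And>v. x v = 1 \<or> x v = -1"
    and deg: "\<And>u. u \<in> V \<Longrightarrow> 2 * (\<Sum>v\<in>V. flip e x u v) \<le> n - 1"
  shows "flips e x * ((n - 1)\<^sup>2 - 4 * n - 4 * flips e x) \<le> 4 * negs"
proof (cases "V = {}")
  case True
  then have "flips e x = 0" "negs = 0" unfolding flips_def negs_def by auto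
  then show ?thesis by simp
next
  case False
  then have n1: "n \<ge> 1" using finite_V by (simp add: Suc_le_eq card_gt_0_iff)
  define H where "H u v = of_bool (v \<noteq> u \<and> v \<noteq> u) - flip e x u v" for u v
  have H: "H u v = 0 \<or> H u v = 1" for u v by (auto simp: H_def flip_def)
  have F: "flip e x u v = 0 \<or> flip e x u v = 1" for u v by (auto simp: flip_def)
  have sumH: "(\<Sum>v\<in>V. H u v) = n - 1 - (\<Sum>v\<in>V. flip e x u v)" if "u \<in> V" for u
    unfolding H_def by (subst sum_subtractf, subst sum_of_bool_neq) (use that in auto)
  \<comment> \<open>From a flipped \<open>u v\<close>, unflipped edges \<open>v w\<close> and
    \<open>u z\<close> give a negative cycle unless \<open>w = z\<close> or \<open>w z\<close> is
    flipped too.\<close>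
  have neg_ge: "flip e x u v * (H v w * H u z - (of_bool (z = w) + flip e x w z)) \<le> neg u v w z"
    if V: "u \<in> V" "v \<in> V" "w \<in> V" "z \<in> V" for u v w z
  proof (cases "flip e x u v = 1 \<and> H v w = 1 \<and> H u z = 1 \<and> z \<noteq> w \<and> flip e x w z = 0")
    case True
    then have "u \<noteq> v" "s u v \<noteq> e * x u * x v" "w \<noteq> v" "s v w = e * x v * x w"
      "z \<noteq> u" "s u z = e * x u * x z" "s w z = e * x w * x z"
      by (auto simp: flip_def H_def of_bool_def split: if_splits)
    then have "s u v * s v w * s w z * s z u = -1"
      using s_sign[OF V(1,2)] e x[of u] x[of v] x[of w] x[of z] s_sym[of z u] by auto
    then show ?thesis using True by (simp add: neg_def)
  next
    case False
    then have "flip e x u v * (H v w * H u z - (of_bool (z = w) + flip e x w z)) \<le> 0"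
      using F[of u v] F[of w z] H[of v w] H[of u z] by auto
    also have "0 \<le> neg u v w z" by (simp add: neg_def)
    finally show ?thesis .
  qed
  have inner: "flip e x u v * ((n - 1)\<^sup>2 - 4 * n - 4 * flips e x) \<le> 4 * (\<Sum>w\<in>V. \<Sum>z\<in>V. neg u v w z)"
    if V: "u \<in> V" "v \<in> V" for u v
  proof -
    \<comment> \<open>Both ends have at least half of their \<open>n - 1\<close> edges unflipped,
      which gives \<open>(n - 1)\<^sup>2 / 4\<close> choices of \<open>w\<close> and
      \<open>z\<close>; the factors of 2 avoid division.\<close>
    have "(n - 1) * (n - 1) \<le> (2 * (\<Sum>w\<in>V. H v w)) * (2 * (\<Sum>z\<in>V. H u z))"
      using deg[OF V(1)] deg[OF V(2)] n1 unfolding sumH[OF V(1)] sumH[OF V(2)]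
      by (intro mult_mono) auto
    then have "(n - 1)\<^sup>2 - 4 * n - 4 * flips e x \<le> 4 * ((\<Sum>w\<in>V. H v w) * (\<Sum>z\<in>V. H u z) - n - flips e x)"
      by (simp add: power2_eq_square)
    then have "flip e x u v * ((n - 1)\<^sup>2 - 4 * n - 4 * flips e x)
      \<le> flip e x u v * (4 * ((\<Sum>w\<in>V. H v w) * (\<Sum>z\<in>V. H u z) - n - flips e x))"
      using F[of u v] by (intro mult_left_mono) auto
    also have "(\<Sum>w\<in>V. H v w) * (\<Sum>z\<in>V. H u z) - n - flips e x
      = (\<Sum>w\<in>V. \<Sum>z\<in>V. H v w * H u z - (of_bool (z = w) + flip e x w z))"
      using finite_V by (simp add: sum_product sum_subtractf sum.distrib flips_def)
    also have "flip e x u v * (4 * \<dots>) = 4 * (\<Sum>w\<in>V. \<Sum>z\<in>V. flip e x u v * (H v w * H u z - (of_bool (z = w) + flip e x w z)))"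
      by (simp only: sum_distrib_left mult.left_commute)
    also have "\<dots> \<le> 4 * (\<Sum>w\<in>V. \<Sum>z\<in>V. neg u v w z)"
      by (intro mult_left_mono sum_mono neg_ge V) auto
    finally show ?thesis .
  qed
  have "flips e x * ((n - 1)\<^sup>2 - 4 * n - 4 * flips e x) =
     (\<Sum>u\<in>V. \<Sum>v\<in>V. flip e x u v * ((n - 1)\<^sup>2 - 4 * n - 4 * flips e x))"
    unfolding flips_def[of e x] sum_distrib_right by simp
  also have "\<dots> \<le> (\<Sum>u\<in>V. \<Sum>v\<in>V. 4 * (\<Sum>w\<in>V. \<Sum>z\<in>V. neg u v w z))"
    by (intro sum_mono inner)
  also have "\<dots> = 4 * negs" by (simp add: negs_def sum_distrib_left)
  finally show ?thesis .
qed

section \<open>Degree terms of the rank-one pattern and removal of flips\<close>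

text \<open>The summand is the signed degree of \<open>u\<close> in the rank-one pattern; the
  \<open>- 1\<close> removes the diagonal term \<open>x u * x u\<close>.\<close>

lemma model_sums:
  assumes "e = 1 \<or> e = -1" "\<And>v. x v = 1 \<or> x v = -1"
  shows "(\<Sum>u\<in>V. (e * (x u * (\<Sum>v\<in>V. x v) - 1))\<^sup>2) = (n - 2) * (\<Sum>v\<in>V. x v)\<^sup>2 + n"
    and "(\<Sum>u\<in>V. e * (x u * (\<Sum>v\<in>V. x v) - 1)) = e * ((\<Sum>v\<in>V. x v)\<^sup>2 - n)"
proof -
  let ?t = "\<Sum>v\<in>V. x v"
  have "(e * (x u * ?t - 1))\<^sup>2 = ?t\<^sup>2 + 1 - 2 * ?t * x u" for u
    using assms(1) assms(2)[of u] by (auto simp: power2_eq_square algebra_simps)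
  then have "(\<Sum>u\<in>V. (e * (x u * ?t - 1))\<^sup>2) = (\<Sum>u\<in>V. ?t\<^sup>2 + 1 - 2 * ?t * x u)" by simp
  then show "(\<Sum>u\<in>V. (e * (x u * ?t - 1))\<^sup>2) = (n - 2) * ?t\<^sup>2 + n"
    by (simp only: sum_subtractf sum.distrib flip: sum_distrib_left) (simp add: power2_eq_square algebra_simps)
  have "(\<Sum>u\<in>V. e * (x u * ?t - 1)) = e * ((\<Sum>u\<in>V. x u) * ?t - n)"
    by (simp add: sum_subtractf flip: sum_distrib_left sum_distrib_right)
  then show "(\<Sum>u\<in>V. e * (x u * ?t - 1)) = e * (?t\<^sup>2 - n)" by (simp add: power2_eq_square)
qed

text \<open>The excess of a rank-one colouring whose sides differ in size by \<open>t\<close>;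
  \<open>e\<close> drops out because the total degree is squared.\<close>

definition model :: "int \<Rightarrow> int" where
  "model t = 8 * ((n - 2) * t\<^sup>2 + n) - 2 * (t\<^sup>2 - n)\<^sup>2"

text \<open>Each flip at \<open>u\<close> moves one summand of the degree by 2. The bounds by
  \<open>n\<close> control the second factor when differences of squares are factored.\<close>

lemma deg_near_model:
  assumes e: "e = 1 \<or> e = -1" and x: "\<And>v. x v = 1 \<or> x v = -1" and u: "u \<in> V"
  shows "\<bar>deg u - e * (x u * (\<Sum>v\<in>V. x v) - 1)\<bar> \<le> 2 * (\<Sum>v\<in>V. flip e x u v)"
    and "\<bar>e * (x u * (\<Sum>v\<in>V. x v) - 1)\<bar> \<le> n" and "\<bar>deg u\<bar> \<le> n"
proof -
  have xx: "x u * x u = 1" using x[of u] by auto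
  have E: "e * (x u * (\<Sum>v\<in>V. x v) - 1) = (\<Sum>v\<in>V. of_bool (v \<noteq> u) * (e * x u * x v))"
  proof -
    have "(\<Sum>v\<in>V. of_bool (v \<noteq> u) * (e * x u * x v)) = (\<Sum>v\<in>V. e * x u * x v - of_bool (v = u) * (e * x u * x u))"
      by (intro sum.cong) auto
    also have "\<dots> = e * x u * (\<Sum>v\<in>V. x v) - e * x u * x u"
      using u finite_V by (simp add: sum_subtractf flip: sum_distrib_left sum_distrib_right)
    finally show ?thesis using xx by (simp add: algebra_simps)
  qed
  have "\<bar>deg u - e * (x u * (\<Sum>v\<in>V. x v) - 1)\<bar> = \<bar>\<Sum>v\<in>V. s u v - of_bool (v \<noteq> u) * (e * x u * x v)\<bar>"
    by (simp only: E deg_def sum_subtractf)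
  also have "\<dots> \<le> (\<Sum>v\<in>V. \<bar>s u v - of_bool (v \<noteq> u) * (e * x u * x v)\<bar>)" by (rule sum_abs)
  also have "\<dots> \<le> (\<Sum>v\<in>V. 2 * flip e x u v)"
  proof (rule sum_mono)
    fix v assume "v \<in> V"
    then show "\<bar>s u v - of_bool (v \<noteq> u) * (e * x u * x v)\<bar> \<le> 2 * flip e x u v"
      using s_cases[OF u, of v] e x[of u] x[of v] by (auto simp: flip_def)
  qed
  finally show "\<bar>deg u - e * (x u * (\<Sum>v\<in>V. x v) - 1)\<bar> \<le> 2 * (\<Sum>v\<in>V. flip e x u v)"
    by (simp add: sum_distrib_left)
  have "\<bar>\<Sum>v\<in>V. of_bool (v \<noteq> u) * (e * x u * x v)\<bar> \<le> (\<Sum>v\<in>V. \<bar>of_bool (v \<noteq> u) * (e * x u * x v)\<bar>)"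
    by (rule sum_abs)
  also have "\<dots> \<le> (\<Sum>v\<in>V. 1)"
  proof (rule sum_mono)
    fix v show "\<bar>of_bool (v \<noteq> u) * (e * x u * x v)\<bar> \<le> 1" using e x[of u] x[of v] by auto
  qed
  finally show "\<bar>e * (x u * (\<Sum>v\<in>V. x v) - 1)\<bar> \<le> n" unfolding E by simp
  have "\<bar>deg u\<bar> \<le> (\<Sum>v\<in>V. \<bar>s u v\<bar>)" unfolding deg_def by (rule sum_abs)
  also have "\<dots> \<le> (\<Sum>v\<in>V. 1)"
    by (rule sum_mono) (use s_cases[OF u] in fastforce)
  finally show "\<bar>deg u\<bar> \<le> n" by simp
qed

text \<open>Around a 4-cycle every vertex sign occurs twice and \<open>e\<close> four times, so no
  cycle is negative, and the degrees are those of the pattern.\<close>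

lemma excess_rank_one:
  assumes e: "e = 1 \<or> e = -1" and x: "\<And>v. x v = 1 \<or> x v = -1"
    and s: "\<And>u v. u \<in> V \<Longrightarrow> v \<in> V \<Longrightarrow> u \<noteq> v \<Longrightarrow> s u v = e * x u * x v"
  shows "excess = model (\<Sum>v\<in>V. x v)"
proof -
  have "deg u = e * (x u * (\<Sum>v\<in>V. x v) - 1)" if "u \<in> V" for u
  proof -
    have "(\<Sum>v\<in>V. flip e x u v) = 0" by (rule sum.neutral) (use s that in \<open>auto simp: flip_def\<close>)
    then show ?thesis using deg_near_model(1)[of e x u, OF e x that] by simp
  qed
  then have "(\<Sum>u\<in>V. (deg u)\<^sup>2) = (n - 2) * (\<Sum>v\<in>V. x v)\<^sup>2 + n"
    "(\<Sum>u\<in>V. deg u) = e * ((\<Sum>v\<in>V. x v)\<^sup>2 - n)"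
    using model_sums[of e x, OF e x] by simp_all
  moreover have "negs = 0"
    unfolding negs_def
  proof (intro sum.neutral ballI)
    fix u v w z assume V: "u \<in> V" "v \<in> V" "w \<in> V" "z \<in> V"
    show "neg u v w z = 0"
    proof (cases "u = v \<or> v = w \<or> w = z \<or> z = u")
      case True then show ?thesis by (auto simp: neg_def)
    next
      case False
      then have "s u v * s v w * s w z * s z u = 1"
        using V s e x[of u] x[of v] x[of w] x[of z] by auto
      then show ?thesis by (simp add: neg_def)
    qed
  qed
  ultimately show ?thesis
    using e unfolding excess_def model_def by (auto simp: power2_commute[of n])
qed

lemma sum_deg_sq_le: "(\<Sum>u\<in>V. (deg u)\<^sup>2) \<le> n ^ 3"
proof -
  have "(deg u)\<^sup>2 \<le> n\<^sup>2" if "u \<in> V" for u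
    using deg_near_model(3)[of 1 "\<lambda>_. 1" u] that power_mono[of "\<bar>deg u\<bar>" n 2] by simp
  then have "(\<Sum>u\<in>V. (deg u)\<^sup>2) \<le> (\<Sum>u\<in>V. n\<^sup>2)" by (rule sum_mono)
  then show ?thesis by (simp add: power2_eq_square power3_eq_cube)
qed

text \<open>The pattern \<open>x\<close> minimises \<open>flips\<close> for a fixed
  \<open>e\<close>. The difference to \<open>model\<close> is bounded by the number of flips times a
  negative factor, so equality leaves no flip.\<close>

lemma excess_le_model:
  assumes n: "n \<ge> 100000" and pos: "excess \<ge> 0"
  obtains e x where "e = 1 \<or> e = (-1::int)" "\<And>v. x v = 1 \<or> x v = (-1::int)"
    "excess \<le> model (\<Sum>v\<in>V. x v)"
    "excess = model (\<Sum>v\<in>V. x v) \<Longrightarrow> \<forall>u\<in>V. \<forall>v\<in>V. u \<noteq> v \<longrightarrow> s u v = e * x u * x v"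
proof -
  define T where "T = (\<Sum>u\<in>V. deg u)"
  have negs0: "negs \<ge> 0" unfolding negs_def by (intro sum_nonneg) (simp add: neg_def)
  have ex: "excess = 8 * (\<Sum>u\<in>V. (deg u)\<^sup>2) - 2 * T\<^sup>2 - 2 * negs"
    by (simp add: excess_def T_def)
  \<comment> \<open>Nonnegative excess means that T^2 plus \<open>negs\<close> is at most four times
    the sum of squared degrees.\<close>
  have negs: "negs \<le> 4 * n ^ 3" and T2: "T\<^sup>2 \<le> 4 * n ^ 3"
    using pos negs0 sum_deg_sq_le zero_le_power2[of T] unfolding ex by linarith+
  \<comment> \<open>Here |T| is at most 2n^(3/2), which is below n^2/100 for n \<ge> 40000.\<close>
  have T: "100 * \<bar>T\<bar> \<le> n\<^sup>2"
  proof (rule power2_le_imp_le)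
    have "(100 * \<bar>T\<bar>)\<^sup>2 \<le> 40000 * n ^ 3" using T2 by (simp add: power_mult_distrib)
    also have "\<dots> \<le> n * n ^ 3" using n by (intro mult_right_mono) auto
    also have "\<dots> = (n\<^sup>2)\<^sup>2" by (simp add: power2_eq_square power3_eq_cube)
    finally show "(100 * \<bar>T\<bar>)\<^sup>2 \<le> (n\<^sup>2)\<^sup>2" .
  qed simp
  obtain e x0 where e: "e = 1 \<or> e = (-1::int)" and x0: "\<And>v. x0 v = 1 \<or> x0 v = (-1::int)"
    and f0: "flips e x0 \<le> 21 * n"
    using nearly_rank_one[OF _ negs] n by auto
  obtain x where x: "\<And>v. x v = 1 \<or> x v = (-1::int)"
    and min: "\<And>y. (\<And>v. y v = 1 \<or> y v = -1) \<Longrightarrow> flips e x \<le> flips e y"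
  proof -
    let ?P = "\<lambda>y. \<forall>v. y v = 1 \<or> y v = (-1::int)"
    have "?P x0" using x0 by blast
    then obtain x where "?P x" "\<forall>y. ?P y \<longrightarrow> nat (flips e x) \<le> nat (flips e y)"
      using ex_has_least_nat[of ?P x0 "\<lambda>x. nat (flips e x)"] by blast
    then show thesis using that[of x] flips_nonneg by (metis nat_le_eq_zle)
  qed
  define f where "f = flips e x"
  have f: "0 \<le> f" "f \<le> 21 * n"
    using flips_nonneg min[of x0] x0 f0 unfolding f_def by auto
  define E where "E u = e * (x u * (\<Sum>v\<in>V. x v) - 1)" for u
  define k where "k u = (\<Sum>v\<in>V. flip e x u v)" for u
  define T0 where "T0 = (\<Sum>u\<in>V. E u)"
  have kf: "(\<Sum>u\<in>V. k u) = f" by (simp add: k_def f_def flips_def)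
  have near: "\<bar>deg u - E u\<bar> \<le> 2 * k u" "\<bar>E u\<bar> \<le> n" "\<bar>deg u\<bar> \<le> n" if "u \<in> V" for u
    using deg_near_model[of e x u, OF e x that] unfolding E_def k_def by auto
  have model: "model (\<Sum>v\<in>V. x v) = 8 * (\<Sum>u\<in>V. (E u)\<^sup>2) - 2 * T0\<^sup>2"
    using e unfolding model_def T0_def E_def model_sums[of e x, OF e x] by (auto simp: power2_commute[of n])
  have "f * ((n - 1)\<^sup>2 - 4 * n - 4 * f) \<le> 4 * negs"
    unfolding f_def by (rule negs_ge[of e x, OF e x minimal_flip_degree[of e x, OF e x _ min]])
  moreover have "(\<Sum>u\<in>V. (deg u)\<^sup>2) \<le> (\<Sum>u\<in>V. (E u)\<^sup>2) + 4 * n * f"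
  proof -
    have "(deg u)\<^sup>2 \<le> (E u)\<^sup>2 + 4 * n * k u" if "u \<in> V" for u
    proof -
      have "(deg u)\<^sup>2 - (E u)\<^sup>2 = (deg u - E u) * (deg u + E u)"
        by (simp add: power2_eq_square algebra_simps)
      also have "\<dots> \<le> \<bar>deg u - E u\<bar> * \<bar>deg u + E u\<bar>" by (simp flip: abs_mult)
      also have "\<dots> \<le> (2 * k u) * (2 * n)"
        using near[OF that] by (intro mult_mono) auto
      finally show ?thesis by (simp add: mult_ac)
    qed
    then have "(\<Sum>u\<in>V. (deg u)\<^sup>2) \<le> (\<Sum>u\<in>V. (E u)\<^sup>2 + 4 * n * k u)" by (rule sum_mono)
    then show ?thesis by (simp add: sum.distrib kf flip: sum_distrib_left)
  qed
  moreover have "T0\<^sup>2 - T\<^sup>2 \<le> 2 * f * (2 * \<bar>T\<bar> + 2 * f)"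
  proof -
    have "\<bar>T0 - T\<bar> = \<bar>\<Sum>u\<in>V. deg u - E u\<bar>" by (simp add: T_def T0_def sum_subtractf)
    also have "\<dots> \<le> (\<Sum>u\<in>V. \<bar>deg u - E u\<bar>)" by (rule sum_abs)
    also have "\<dots> \<le> (\<Sum>u\<in>V. 2 * k u)" by (intro sum_mono near)
    finally have d: "\<bar>T0 - T\<bar> \<le> 2 * f" by (simp add: kf flip: sum_distrib_left)
    have "T0\<^sup>2 - T\<^sup>2 = (T0 - T) * (T0 + T)" by (simp add: power2_eq_square algebra_simps)
    also have "\<dots> \<le> \<bar>T0 - T\<bar> * \<bar>T0 + T\<bar>" by (simp flip: abs_mult)
    also have "\<dots> \<le> (2 * f) * (2 * \<bar>T\<bar> + 2 * f)"
      using d by (intro mult_mono) auto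
    finally show ?thesis .
  qed
  \<comment> \<open>The degree squares contribute \<open>64 * n\<close>, the total degree
    \<open>16 * \<bar>T\<bar> + 16 * f\<close>, and the negative cycles the remaining terms.\<close>
  ultimately have gap: "2 * (excess - model (\<Sum>v\<in>V. x v)) \<le>
     f * (64 * n + 16 * \<bar>T\<bar> + 20 * f + 4 * n - (n - 1)\<^sup>2)"
    unfolding ex model by (simp add: algebra_simps)
  have "64 * n + 16 * \<bar>T\<bar> + 20 * f + 4 * n - (n - 1)\<^sup>2 < 0"
  proof -
    have "100000 * n \<le> n\<^sup>2" using n by (simp add: power2_eq_square)
    moreover have "(n - 1)\<^sup>2 = n\<^sup>2 - 2 * n + 1" by (simp add: power2_eq_square algebra_simps)
    ultimately show ?thesis using T f n by linarith
  qed
  then have neg: "f * (64 * n + 16 * \<bar>T\<bar> + 20 * f + 4 * n - (n - 1)\<^sup>2) < 0" if "f \<noteq> 0"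
    using f(1) that by (simp add: mult_less_0_iff)
  show thesis
  proof (rule that[OF e x])
    show "excess \<le> model (\<Sum>v\<in>V. x v)" using gap neg by (cases "f = 0") auto
    assume "excess = model (\<Sum>v\<in>V. x v)"
    then have "f = 0" using gap neg by auto
    then have "flip e x u v = 0" if "u \<in> V" "v \<in> V" for u v
    proof -
      have "flip e x a b \<ge> 0" for a b by (simp add: flip_def)
      then show ?thesis
        using that finite_V \<open>f = 0\<close> unfolding f_def flips_def
        by (simp add: sum_nonneg_eq_0_iff sum_nonneg)
    qed
    then show "\<forall>u\<in>V. \<forall>v\<in>V. u \<noteq> v \<longrightarrow> s u v = e * x u * x v"
      by (auto simp: flip_def)
  qed
qed

end

section \<open>RRBB-cycles\<close>

definition edge_sign :: "('a set \<Rightarrow> colour) \<Rightarrow> 'a \<Rightarrow> 'a \<Rightarrow> int" where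
  "edge_sign c u v = (if u = v then 0 else if c {u, v} = Red then 1 else -1)"

text \<open>The possible middle vertices of an RRBB-cycle whose red edges meet in \<open>u\<close>
  and whose blue edges meet in \<open>w\<close>.\<close>

definition red_blue_nbrs :: "'a set \<Rightarrow> ('a set \<Rightarrow> colour) \<Rightarrow> 'a \<Rightarrow> 'a \<Rightarrow> 'a set" where
  "red_blue_nbrs V c u w = {v \<in> V - {u, w}. c {u, v} = Red \<and> c {w, v} = Blue}"

lemma not_Red: "k \<noteq> Red \<longleftrightarrow> k = Blue"
  by (cases k) auto

lemma signed_edge_sign: "finite V \<Longrightarrow> signed_complete_graph V (edge_sign c)"
  by unfold_locales (simp_all add: edge_sign_def insert_commute)

text \<open>Four times the indicator of such a \<open>v\<close> is
  \<open>(1 + s u v) * (1 - s w v)\<close>, for \<open>s\<close> the edge sign; the corrections at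
  \<open>v = u\<close> and \<open>v = w\<close> cancel by symmetry.\<close>

lemma card_red_blue_nbrs:
  assumes "finite V" "u \<in> V" "w \<in> V" "u \<noteq> w"
  shows "4 * int (card (red_blue_nbrs V c u w)) = int (card V) - 2
    - signed_complete_graph.codeg V (edge_sign c) u w
    + signed_complete_graph.deg V (edge_sign c) u - signed_complete_graph.deg V (edge_sign c) w"
proof -
  interpret signed_complete_graph V "edge_sign c" by (rule signed_edge_sign) fact
  let ?s = "edge_sign c"
  have "4 * int (card (red_blue_nbrs V c u w)) = 4 * (\<Sum>v\<in>V. of_bool (v \<in> red_blue_nbrs V c u w))"
  proof -
    have "red_blue_nbrs V c u w = {v \<in> V. v \<in> red_blue_nbrs V c u w}" by (auto simp: red_blue_nbrs_def)
    then have "int (card (red_blue_nbrs V c u w)) = (\<Sum>v\<in>{v \<in> V. v \<in> red_blue_nbrs V c u w}. 1)" by simp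
    also have "\<dots> = (\<Sum>v\<in>V. of_bool (v \<in> red_blue_nbrs V c u w))"
      using assms(1) by (simp only: sum.inter_filter of_bool_def)
    finally show ?thesis by simp
  qed
  also have "\<dots> = (\<Sum>v\<in>V. of_bool (v \<noteq> u \<and> v \<noteq> w) - ?s u v * ?s w v + ?s u v - ?s w v
      - of_bool (v = w) * ?s u w + of_bool (v = u) * ?s w u)"
    unfolding sum_distrib_left
    by (rule sum.cong) (auto simp: edge_sign_def red_blue_nbrs_def not_Red)
  also have "\<dots> = (\<Sum>v\<in>V. of_bool (v \<noteq> u \<and> v \<noteq> w)) - codeg u w + deg u - deg w - ?s u w + ?s w u"
    using assms by (simp add: sum.distrib sum_subtractf deg_def codeg_def flip: sum_distrib_right)
  also have "\<dots> = int (card V) - 2 - codeg u w + deg u - deg w"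
    unfolding sum_of_bool_neq[OF assms(2,3)] s_sym[of w u] using assms(4) by simp
  finally show ?thesis .
qed

section \<open>RRBB-cycles as a red and a blue cherry on a common pair of ends\<close>

definition cherry_cycle :: "'a \<Rightarrow> 'a \<Rightarrow> 'a set \<Rightarrow> 'a set set" where
  "cherry_cycle u w W = (\<lambda>v. {u, v}) ` W \<union> (\<lambda>v. {w, v}) ` W"

text \<open>Recovers both centres and the middle pair from the coloured cycle, which gives
  injectivity of the parametrisation.\<close>

lemma cherry_cycle_determines:
  assumes W: "W \<subseteq> red_blue_nbrs V c u w" "card W = 2"
  shows "{u} = \<Inter> {g \<in> cherry_cycle u w W. c g = Red}"
    and "{w} = \<Inter> {g \<in> cherry_cycle u w W. c g = Blue}"
    and "W = \<Union> {g \<in> cherry_cycle u w W. c g = Red} - {u}"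
proof -
  obtain v v' where v: "W = {v, v'}" "v \<noteq> v'" using W(2) by (auto simp: card_2_iff)
  have r: "{g \<in> cherry_cycle u w W. c g = Red} = {{u, v}, {u, v'}}"
    and b: "{g \<in> cherry_cycle u w W. c g = Blue} = {{w, v}, {w, v'}}"
    using W v by (auto simp: cherry_cycle_def red_blue_nbrs_def)
  show "{u} = \<Inter> {g \<in> cherry_cycle u w W. c g = Red}"
    and "{w} = \<Inter> {g \<in> cherry_cycle u w W. c g = Blue}"
    and "W = \<Union> {g \<in> cherry_cycle u w W. c g = Red} - {u}"
    unfolding r b using W v by (auto simp: red_blue_nbrs_def)
qed

lemma cherry_cycle_in_RRBB:
  assumes uw: "u \<in> V" "w \<in> V" "u \<noteq> w" and W: "W \<subseteq> red_blue_nbrs V c u w" "card W = 2"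
  shows "cherry_cycle u w W \<in> RRBB_cycles V c"
proof -
  obtain v v' where v: "W = {v, v'}" "v \<noteq> v'" using W(2) by (auto simp: card_2_iff)
  have "cherry_cycle u w W = {{u, v}, {v, w}, {w, v'}, {v', u}}"
    unfolding cherry_cycle_def v by auto
  moreover have "{u, v, w, v'} \<subseteq> V \<and> distinct [u, v, w, v']"
    using uw W v by (auto simp: red_blue_nbrs_def)
  ultimately have "cherry_cycle u w W \<in> four_cycles V" unfolding four_cycles_def by blast
  moreover have "{g \<in> cherry_cycle u w W. c g = Red} = {{u, v}, {u, v'}}"
    using W v by (auto simp: cherry_cycle_def red_blue_nbrs_def)
  moreover have "{u, v} \<noteq> {u, v'}" "{u, v} \<inter> {u, v'} \<noteq> {}" using v by (auto simp: doubleton_eq_iff)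
  ultimately show ?thesis
    unfolding RRBB_cycles_def mem_Collect_eq by (intro conjI exI)
qed

lemma RRBB_is_cherry_cycle:
  assumes "C \<in> RRBB_cycles V c"
  obtains u w W where "u \<in> V" "w \<in> V" "u \<noteq> w" "W \<subseteq> red_blue_nbrs V c u w" "card W = 2"
    "C = cherry_cycle u w W"
proof -
  from assms obtain e f where C4: "C \<in> four_cycles V"
    and ef: "e \<noteq> f" "{g \<in> C. c g = Red} = {e, f}" "e \<inter> f \<noteq> {}"
    unfolding RRBB_cycles_def by blast
  from C4 obtain w x y z where V: "{w, x, y, z} \<subseteq> V" and d: "distinct [w, x, y, z]"
    and C: "C = {{w, x}, {x, y}, {y, z}, {z, w}}"
    unfolding four_cycles_def by blast
  have "e \<in> C" "f \<in> C" and red: "\<forall>g\<in>C. c g = Red \<longleftrightarrow> g = e \<or> g = f" using ef(2) by auto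
  \<comment> \<open>Opposite edges of a 4-cycle are disjoint, so the two red edges are consecutive
    and meet in one of the four vertices.\<close>
  have cases: "(c {w, x} = Red \<and> c {z, w} = Red \<and> c {x, y} = Blue \<and> c {y, z} = Blue) \<or>
    (c {x, y} = Red \<and> c {w, x} = Red \<and> c {y, z} = Blue \<and> c {z, w} = Blue) \<or>
    (c {y, z} = Red \<and> c {x, y} = Red \<and> c {z, w} = Blue \<and> c {w, x} = Blue) \<or>
    (c {z, w} = Red \<and> c {y, z} = Red \<and> c {w, x} = Blue \<and> c {x, y} = Blue)"
  proof -
    have "e = {w, x} \<or> e = {x, y} \<or> e = {y, z} \<or> e = {z, w}"
      "f = {w, x} \<or> f = {x, y} \<or> f = {y, z} \<or> f = {z, w}"
      using \<open>e \<in> C\<close> \<open>f \<in> C\<close> C by auto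
    moreover have "w \<noteq> x" "x \<noteq> w" "w \<noteq> y" "y \<noteq> w" "w \<noteq> z" "z \<noteq> w"
      "x \<noteq> y" "y \<noteq> x" "x \<noteq> z" "z \<noteq> x" "y \<noteq> z" "z \<noteq> y"
      using d by auto
    ultimately show ?thesis
      using ef(1,3) red unfolding C not_Red[symmetric]
      by (elim disjE) (simp_all add: doubleton_eq_iff)
  qed
  have cherry: "\<exists>u w W. u \<in> V \<and> w \<in> V \<and> u \<noteq> w \<and> W \<subseteq> red_blue_nbrs V c u w \<and> card W = 2 \<and> C = cherry_cycle u w W"
    if "C = {{u, v}, {v, u'}, {u', v'}, {v', u}}" "{u, v, u', v'} \<subseteq> V" "distinct [u, v, u', v']"
      "c {u, v} = Red" "c {v', u} = Red" "c {v, u'} = Blue" "c {u', v'} = Blue" for u v u' v'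
  proof (intro exI conjI)
    show "{v, v'} \<subseteq> red_blue_nbrs V c u u'"
      using that(2-) by (simp add: red_blue_nbrs_def insert_commute) blast
    show "C = cherry_cycle u u' {v, v'}" unfolding that(1) cherry_cycle_def by auto
  qed (use that(2,3) in auto)
  \<comment> \<open>Rotating the list of edges brings the common vertex of the red edges to the
    front, as \<open>cherry\<close> requires.\<close>
  have rot: "{p, q, r, t} = {q, r, t, p}" for p q r t :: "'a set" by auto
  note C1 = trans[OF C rot] and C2 = trans[OF trans[OF C rot] rot]
  note C3 = trans[OF C2 rot]
  have "\<exists>u w W. u \<in> V \<and> w \<in> V \<and> u \<noteq> w \<and> W \<subseteq> red_blue_nbrs V c u w \<and> card W = 2 \<and> C = cherry_cycle u w W"
    using cases
  proof (elim disjE conjE)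
    assume "c {w, x} = Red" "c {z, w} = Red" "c {x, y} = Blue" "c {y, z} = Blue"
    then show ?thesis by (intro cherry[OF C]) (use V d in auto)
  next
    assume "c {x, y} = Red" "c {w, x} = Red" "c {y, z} = Blue" "c {z, w} = Blue"
    then show ?thesis by (intro cherry[OF C1]) (use V d in auto)
  next
    assume "c {y, z} = Red" "c {x, y} = Red" "c {z, w} = Blue" "c {w, x} = Blue"
    then show ?thesis by (intro cherry[OF C2]) (use V d in auto)
  next
    assume "c {z, w} = Red" "c {y, z} = Red" "c {w, x} = Blue" "c {x, y} = Blue"
    then show ?thesis by (intro cherry[OF C3]) (use V d in auto)
  qed
  then show thesis using that by blast
qed

text \<open>Red and blue centres play different roles, so ordered pairs \<open>(u, w)\<close> count
  each cycle exactly once.\<close>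

lemma card_RRBB_cycles:
  assumes V: "finite V"
  shows "card (RRBB_cycles V c) = (\<Sum>u\<in>V. \<Sum>w\<in>V - {u}. card (red_blue_nbrs V c u w) choose 2)"
proof -
  define S where "S = (SIGMA u:V. SIGMA w:V - {u}. {W. W \<subseteq> red_blue_nbrs V c u w \<and> card W = 2})"
  have fin: "finite (red_blue_nbrs V c u w)" for u w using V by (simp add: red_blue_nbrs_def)
  have "bij_betw (\<lambda>(u, w, W). cherry_cycle u w W) S (RRBB_cycles V c)"
  proof (rule bij_betwI')
    fix p q assume pq: "p \<in> S" "q \<in> S"
    obtain u w W u' w' W' where p: "p = (u, w, W)" and q: "q = (u', w', W')" by (metis prod_cases3)
    have W: "W \<subseteq> red_blue_nbrs V c u w" "card W = 2" and W': "W' \<subseteq> red_blue_nbrs V c u' w'" "card W' = 2"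
      using pq unfolding S_def p q by auto
    have "p = q" if eq: "cherry_cycle u w W = cherry_cycle u' w' W'"
    proof -
      note d = cherry_cycle_determines[OF W] and d' = cherry_cycle_determines[OF W', folded eq]
      have "{u} = {u'}" "{w} = {w'}" by (rule trans[OF d(1) d'(1)[symmetric]] trans[OF d(2) d'(2)[symmetric]])+
      then have "u = u'" "w = w'" by simp_all
      moreover have "W = W'" using d(3) d'(3) \<open>u = u'\<close> by metis
      ultimately show ?thesis by (simp add: p q)
    qed
    then show "((case p of (u, w, W) \<Rightarrow> cherry_cycle u w W) = (case q of (u, w, W) \<Rightarrow> cherry_cycle u w W)) = (p = q)"
      by (auto simp: p q)
  next
    fix p assume "p \<in> S"
    then show "(case p of (u, w, W) \<Rightarrow> cherry_cycle u w W) \<in> RRBB_cycles V c"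
      by (auto simp: S_def intro!: cherry_cycle_in_RRBB)
  next
    fix C assume "C \<in> RRBB_cycles V c"
    then show "\<exists>p\<in>S. C = (case p of (u, w, W) \<Rightarrow> cherry_cycle u w W)"
    proof (rule RRBB_is_cherry_cycle)
      fix u w W assume "u \<in> V" "w \<in> V" "u \<noteq> w" "W \<subseteq> red_blue_nbrs V c u w" "card W = 2"
        "C = cherry_cycle u w W"
      then show ?thesis by (intro bexI[of _ "(u, w, W)"]) (auto simp: S_def)
    qed
  qed
  then have "card (RRBB_cycles V c) = card S" by (simp add: bij_betw_same_card)
  also have "\<dots> = (\<Sum>u\<in>V. \<Sum>w\<in>V - {u}. card (red_blue_nbrs V c u w) choose 2)"
    unfolding S_def using V fin by (simp add: n_subsets)
  finally show ?thesis .
qed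

section \<open>From counts to part sizes\<close>

lemma two_times_choose_2: "2 * int (m choose 2) = int m * (int m - 1)"
proof (induction m)
  case (Suc m)
  have "Suc m choose 2 = m + (m choose 2)" by (simp add: numeral_2_eq_2)
  then show ?case using Suc.IH by (simp add: algebra_simps)
qed simp

lemma card_RRBB_cycles_excess:
  assumes V: "finite V"
  shows "32 * int (card (RRBB_cycles V c)) =
    2 * int (card V) * (int (card V) - 1)\<^sup>2 * (int (card V) - 4) + signed_complete_graph.excess V (edge_sign c)"
proof -
  interpret signed_complete_graph V "edge_sign c" by (rule signed_edge_sign) fact
  define p where "p u w = int (card (red_blue_nbrs V c u w))" for u w
  have "32 * int (card (RRBB_cycles V c)) = 16 * (\<Sum>u\<in>V. \<Sum>w\<in>V - {u}. 2 * int (card (red_blue_nbrs V c u w) choose 2))"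
    by (simp add: card_RRBB_cycles[OF V] flip: sum_distrib_left)
  also have "\<dots> = 16 * (\<Sum>u\<in>V. \<Sum>w\<in>V - {u}. p u w * (p u w - 1))"
    by (simp only: two_times_choose_2 p_def)
  also have "\<dots> = 2 * n * (n - 1)\<^sup>2 * (n - 4) + excess"
    by (rule sum_pairs_eq_excess) (simp add: p_def card_red_blue_nbrs V)
  finally show ?thesis .
qed

text \<open>Completing the square in \<open>(2 * int a - int n)\<^sup>2\<close>; writing
  \<open>n = a + b\<close> removes the truncated subtraction.\<close>

lemma RRBB_bound_eq:
  assumes "a \<le> n"
  shows "16 * int (RRBB_bound n a) = int n ^ 4 - 6 * int n ^ 3 + 8 * (int n)\<^sup>2 + (3 * int n - 4)\<^sup>2
    - ((2 * int a - int n)\<^sup>2 - (3 * int n - 4))\<^sup>2"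
proof -
  have three: "6 * int (m choose 3) = int m * (int m - 1) * (int m - 2)" for m
  proof (induction m)
    case (Suc m)
    have "Suc m choose 3 = (m choose 2) + (m choose 3)"
      by (simp add: numeral_3_eq_3 numeral_2_eq_2)
    then show ?case using Suc.IH two_times_choose_2[of m] by (simp add: algebra_simps)
  qed simp
  obtain b where b: "n = a + b" using assms le_Suc_ex by blast
  have "16 * int (RRBB_bound n a) = 8 * (int a * (6 * int (b choose 3)) + int b * (6 * int (a choose 3)))"
    by (simp add: RRBB_bound_def b algebra_simps)
  then show ?thesis
    unfolding three b by (simp add: power2_eq_square power3_eq_cube power4_eq_xxxx algebra_simps)
qed

lemma is_complete_bipartite_commute:
  assumes "is_complete_bipartite V E a b"
  shows "is_complete_bipartite V E b a"
proof -
  from assms obtain X Y where XY: "X \<union> Y = V" "X \<inter> Y = {}" "card X = a" "card Y = b"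
    and E: "E = {{x, y} | x y. x \<in> X \<and> y \<in> Y}"
    unfolding is_complete_bipartite_def by blast
  have "E = {{x, y} | x y. x \<in> Y \<and> y \<in> X}"
    unfolding E by (auto simp: insert_commute)
  then show ?thesis
    unfolding is_complete_bipartite_def using XY by (intro exI[of _ Y] exI[of _ X]) auto
qed

lemma sum_sign_vector:
  assumes "finite V" "X \<subseteq> V"
  shows "(\<Sum>v\<in>V. if v \<in> X then 1 else -1 :: int) = 2 * int (card X) - int (card V)"
proof -
  have "(\<Sum>v\<in>V. if v \<in> X then 1 else -1 :: int) = (\<Sum>v\<in>V. 2 * of_bool (v \<in> X) - 1)"
    by (rule sum.cong) auto
  also have "\<dots> = 2 * int (card (V \<inter> X)) - int (card V)"
    using assms(1) by (simp add: sum_subtractf flip: sum_distrib_left)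
  also have "V \<inter> X = X" using assms(2) by blast
  finally show ?thesis .
qed

text \<open>Makes comparing a cycle count with \<open>RRBB_bound\<close> the same as comparing
  \<open>excess\<close> with \<open>model\<close>.\<close>

lemma RRBB_bound_eq_model:
  assumes "finite V" "a \<le> card V"
  shows "32 * int (RRBB_bound (card V) a) = 2 * int (card V) * (int (card V) - 1)\<^sup>2 * (int (card V) - 4)
    + signed_complete_graph.model V (2 * int a - int (card V))"
proof -
  interpret signed_complete_graph V "edge_sign c" by (rule signed_edge_sign) fact
  define t where "t = 2 * int a - int (card V)"
  have "32 * int (RRBB_bound (card V) a) = 2 * (16 * int (RRBB_bound (card V) a))" by simp
  then show ?thesis
    unfolding RRBB_bound_eq[OF assms(2)] model_def t_def[symmetric]
    by (simp add: power2_eq_square power3_eq_cube power4_eq_xxxx algebra_simps)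
qed

lemma card_RRBB_cycles_bipartite:
  assumes V: "finite V" and bip: "is_complete_bipartite V (colour_class V c k) a b"
  shows "card (RRBB_cycles V c) = RRBB_bound (card V) a"
proof -
  interpret signed_complete_graph V "edge_sign c" by (rule signed_edge_sign) fact
  from bip obtain X Y where XY: "X \<union> Y = V" "X \<inter> Y = {}" "card X = a"
    and E: "colour_class V c k = {{x, y} | x y. x \<in> X \<and> y \<in> Y}"
    unfolding is_complete_bipartite_def by blast
  define x where "x v = (if v \<in> X then 1 else -1 :: int)" for v
  \<comment> \<open>Edges between the parts have \<open>x u * x v = -1\<close>, so the bipartite
    colour is the one of sign \<open>- e\<close>.\<close>
  define e where "e = (if k = Red then -1 else 1 :: int)"
  have "excess = model (\<Sum>v\<in>V. x v)"
  proof (rule excess_rank_one)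
    fix u v assume uv: "u \<in> V" "v \<in> V" "u \<noteq> v"
    have "c {u, v} = k \<longleftrightarrow> {u, v} \<in> colour_class V c k"
      using uv by (simp add: colour_class_def complete_edges_def)
    also have "\<dots> \<longleftrightarrow> (u \<in> X \<longleftrightarrow> v \<notin> X)"
    proof -
      have "u \<in> Y \<longleftrightarrow> u \<notin> X" "v \<in> Y \<longleftrightarrow> v \<notin> X" using XY uv by auto
      then show ?thesis unfolding E by (auto simp: doubleton_eq_iff)
    qed
    finally have *: "c {u, v} = k \<longleftrightarrow> (u \<in> X \<longleftrightarrow> v \<notin> X)" .
    show "edge_sign c u v = e * x u * x v"
      using * uv(3) by (cases k; cases "c {u, v}") (auto simp: edge_sign_def e_def x_def)
  qed (auto simp: e_def x_def)
  also have "(\<Sum>v\<in>V. x v) = 2 * int a - int (card V)"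
    unfolding x_def using sum_sign_vector[OF V, of X] XY by auto
  finally have "excess = model (2 * int a - int (card V))" .
  moreover have "a \<le> card V" using XY V by (auto intro: card_mono)
  ultimately show ?thesis
    using card_RRBB_cycles_excess[OF V, of c] RRBB_bound_eq_model[OF V, of a] by linarith
qed

lemma bipartite_if_rank_one:
  assumes V: "finite V" and e: "e = 1 \<or> e = (-1::int)"
    and s: "\<forall>u\<in>V. \<forall>v\<in>V. u \<noteq> v \<longrightarrow> edge_sign c u v = e * (if u \<in> X then 1 else -1) * (if v \<in> X then 1 else -1)"
    and X: "X \<subseteq> V"
  shows "\<exists>k. is_complete_bipartite V (colour_class V c k) (card X) (card V - card X)"
proof -
  define k where "k = (if e = 1 then Blue else Red)"
  have k: "c {u, v} = k \<longleftrightarrow> (u \<in> X \<longleftrightarrow> v \<notin> X)" if "u \<in> V" "v \<in> V" "u \<noteq> v" for u v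
    using s[rule_format, OF that] e that
    by (cases "c {u, v}") (auto simp: k_def edge_sign_def split: if_splits)
  have "colour_class V c k = {{x, y} | x y. x \<in> X \<and> y \<in> V - X}"
  proof (intro equalityI subsetI)
    fix g assume "g \<in> colour_class V c k"
    then obtain u v where g: "g = {u, v}" "u \<noteq> v" "u \<in> V" "v \<in> V" "c {u, v} = k"
      by (auto simp: colour_class_def complete_edges_def card_2_iff)
    then have "u \<in> X \<longleftrightarrow> v \<notin> X" using k by simp
    then show "g \<in> {{x, y} | x y. x \<in> X \<and> y \<in> V - X}"
      using g by (cases "u \<in> X") (auto simp: doubleton_eq_iff)
  next
    fix g assume "g \<in> {{x, y} | x y. x \<in> X \<and> y \<in> V - X}"
    then obtain u v where g: "g = {u, v}" "u \<in> X" "v \<in> V - X" by blast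
    then have "u \<in> V" "v \<in> V" "u \<noteq> v" using X by auto
    then show "g \<in> colour_class V c k"
      using k[of u v] g by (simp add: colour_class_def complete_edges_def)
  qed
  then show ?thesis
    using V X unfolding is_complete_bipartite_def
    by (intro exI[of _ k] exI[of _ X] exI[of _ "V - X"]) (simp add: card_Diff_subset finite_subset Un_absorb1)
qed

text \<open>The first alternative is negative excess, to be excluded for extremal colourings by
  comparison with the optimum; the second is the comparison with a rank-one pattern.\<close>

lemma RRBB_cycles_le_some_bound:
  assumes V: "finite V" and n: "card V \<ge> 100000"
  shows "32 * int (card (RRBB_cycles V c)) < 2 * int (card V) * (int (card V) - 1)\<^sup>2 * (int (card V) - 4) \<or>
    (\<exists>a\<le>card V. card (RRBB_cycles V c) \<le> RRBB_bound (card V) a \<and>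
      (card (RRBB_cycles V c) = RRBB_bound (card V) a \<longrightarrow>
        (\<exists>k. is_complete_bipartite V (colour_class V c k) a (card V - a))))"
proof (cases "signed_complete_graph.excess V (edge_sign c) < 0")
  case True
  then show ?thesis using card_RRBB_cycles_excess[OF V, of c] by linarith
next
  case False
  interpret signed_complete_graph V "edge_sign c" by (rule signed_edge_sign) fact
  obtain e x where e: "e = 1 \<or> e = (-1::int)" and x: "\<And>v. x v = 1 \<or> x v = (-1::int)"
    and le: "excess \<le> model (\<Sum>v\<in>V. x v)"
    and eq: "excess = model (\<Sum>v\<in>V. x v) \<Longrightarrow> \<forall>u\<in>V. \<forall>v\<in>V. u \<noteq> v \<longrightarrow> edge_sign c u v = e * x u * x v"
    using excess_le_model False n by (auto simp: not_less)
  define X where "X = {v \<in> V. x v = 1}"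
  have xX: "x v = (if v \<in> X then 1 else -1)" if "v \<in> V" for v using x[of v] that by (auto simp: X_def)
  have X: "X \<subseteq> V" by (auto simp: X_def)
  then have aV: "card X \<le> card V" using V by (simp add: card_mono)
  have "(\<Sum>v\<in>V. x v) = (\<Sum>v\<in>V. if v \<in> X then 1 else -1)" by (rule sum.cong) (simp_all add: xX)
  then have sum: "(\<Sum>v\<in>V. x v) = 2 * int (card X) - int (card V)" using sum_sign_vector[OF V X] by simp
  note count = card_RRBB_cycles_excess[OF V, of c] RRBB_bound_eq_model[OF V aV]
  have "card (RRBB_cycles V c) \<le> RRBB_bound (card V) (card X)"
    using count le unfolding sum by linarith
  moreover have "\<exists>k. is_complete_bipartite V (colour_class V c k) (card X) (card V - card X)"
    if "card (RRBB_cycles V c) = RRBB_bound (card V) (card X)"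
  proof -
    have "excess = model (\<Sum>v\<in>V. x v)" using count that unfolding sum by linarith
    then have "\<forall>u\<in>V. \<forall>v\<in>V. u \<noteq> v \<longrightarrow>
       edge_sign c u v = e * (if u \<in> X then 1 else -1) * (if v \<in> X then 1 else -1)"
      using eq xX by simp
    then show ?thesis using bipartite_if_rank_one[OF V e _ X] by blast
  qed
  ultimately show ?thesis using aV by blast
qed

section \<open>Optimal part sizes\<close>

definition opt_floor :: "nat \<Rightarrow> nat" where
  "opt_floor n = nat \<lfloor>(1/2) * (real n + sqrt (3 * real n - 4))\<rfloor>"

definition opt_ceiling :: "nat \<Rightarrow> nat" where
  "opt_ceiling n = nat \<lceil>(1/2) * (real n + sqrt (3 * real n - 4))\<rceil>"

text \<open>Which of the two roundings is better depends on \<open>n\<close>; in a tie both sizes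
  are extremal.\<close>

definition opt_bound :: "nat \<Rightarrow> nat" where
  "opt_bound n = max (RRBB_bound n (opt_floor n)) (RRBB_bound n (opt_ceiling n))"

text \<open>At the two roundings \<open>2 * a - n\<close> brackets the root of 3n - 4; the integer
  form keeps real numbers out of what follows.\<close>

lemma opt_properties:
  assumes n: "n \<ge> 100000"
  shows "0 \<le> 2 * int (opt_floor n) - int n"
    and "(2 * int (opt_floor n) - int n)\<^sup>2 \<le> 3 * int n - 4"
    and "0 \<le> 2 * int (opt_ceiling n) - int n"
    and "3 * int n - 4 \<le> (2 * int (opt_ceiling n) - int n)\<^sup>2"
    and "opt_floor n \<le> opt_ceiling n" "opt_ceiling n \<le> opt_floor n + 1" "opt_ceiling n \<le> n"
proof -
  define r where "r = sqrt (3 * real n - 4)"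
  define b where "b = (1/2) * (real n + r)"
  have r2: "r\<^sup>2 = 3 * real n - 4" unfolding r_def using n by simp
  have r_ge: "r \<ge> 2" unfolding r_def using n by (intro real_le_rsqrt) simp
  have r_le: "r \<le> real n - 2"
    unfolding r_def
  proof (rule real_le_lsqrt)
    have "100000 * real n \<le> real n * real n" using n by (intro mult_right_mono) auto
    moreover have "(real n - 2)\<^sup>2 = real n * real n - 4 * real n + 4"
      by (simp add: power2_eq_square algebra_simps)
    ultimately show "3 * real n - 4 \<le> (real n - 2)\<^sup>2" using n by linarith
  qed (use n in auto)
  have b0: "b \<ge> 0" using r_ge by (simp add: b_def)
  have fl: "opt_floor n = nat \<lfloor>b\<rfloor>" and ce: "opt_ceiling n = nat \<lceil>b\<rceil>"
    by (simp_all add: opt_floor_def opt_ceiling_def b_def r_def)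
  have fl': "real (opt_floor n) \<le> b" "b < real (opt_floor n) + 1"
    unfolding fl using b0 by (simp_all add: of_nat_nat)
  have ce': "b \<le> real (opt_ceiling n)" "real (opt_ceiling n) < b + 1"
    unfolding ce using b0 by (simp_all add: of_nat_nat) linarith
  have "real n \<le> 2 * real (opt_floor n)" using fl' r_ge unfolding b_def by simp
  then show fl0: "0 \<le> 2 * int (opt_floor n) - int n" by linarith
  have "real n \<le> 2 * real (opt_ceiling n)" using ce' r_ge unfolding b_def by simp
  then show "0 \<le> 2 * int (opt_ceiling n) - int n" by linarith
  have "(2 * real (opt_floor n) - real n)\<^sup>2 \<le> r\<^sup>2"
    using fl' \<open>real n \<le> 2 * real (opt_floor n)\<close> unfolding b_def by (intro power_mono) auto
  then have "real_of_int ((2 * int (opt_floor n) - int n)\<^sup>2) \<le> real_of_int (3 * int n - 4)"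
    unfolding r2 by simp
  then show "(2 * int (opt_floor n) - int n)\<^sup>2 \<le> 3 * int n - 4" by linarith
  have "r\<^sup>2 \<le> (2 * real (opt_ceiling n) - real n)\<^sup>2"
    using ce' r_ge unfolding b_def by (intro power_mono) auto
  then have "real_of_int (3 * int n - 4) \<le> real_of_int ((2 * int (opt_ceiling n) - int n)\<^sup>2)"
    unfolding r2 by simp
  then show "3 * int n - 4 \<le> (2 * int (opt_ceiling n) - int n)\<^sup>2" by linarith
  show "opt_floor n \<le> opt_ceiling n" using fl' ce' by linarith
  show "opt_ceiling n \<le> opt_floor n + 1" unfolding fl ce using b0 by linarith
  have "b \<le> real n - 1" using r_le by (simp add: b_def)
  then show "opt_ceiling n \<le> n" using ce' by linarith
qed

text \<open>Rounding up adds at most 2 to \<open>d\<close>, so \<open>(d + 2)\<^sup>2\<close>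
  reaches the vertex 3n - 4, and it is at most \<open>2 * d\<^sup>2\<close> for
  \<open>d \<ge> 5\<close>.\<close>

lemma opt_floor_near:
  assumes n: "n \<ge> 100000"
  shows "3 * int n - 4 \<le> 2 * (2 * int (opt_floor n) - int n)\<^sup>2"
proof -
  note o = opt_properties[OF n]
  define d where "d = 2 * int (opt_floor n) - int n"
  have "3 * int n - 4 \<le> (d + 2)\<^sup>2"
  proof (rule order_trans[OF o(4)])
    show "(2 * int (opt_ceiling n) - int n)\<^sup>2 \<le> (d + 2)\<^sup>2"
      using o unfolding d_def by (intro power_mono) auto
  qed
  moreover have "d \<ge> 5"
  proof (rule ccontr)
    assume "\<not> d \<ge> 5"
    then have "(d + 2)\<^sup>2 \<le> 7\<^sup>2" using o(1) unfolding d_def by (intro power_mono) auto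
    then show False using \<open>3 * int n - 4 \<le> (d + 2)\<^sup>2\<close> n by simp
  qed
  moreover from \<open>d \<ge> 5\<close> have "5 * d \<le> d\<^sup>2" unfolding power2_eq_square by (intro mult_right_mono) auto
  moreover have "(d + 2)\<^sup>2 = d\<^sup>2 + 4 * d + 4" by (simp add: power2_eq_square algebra_simps)
  ultimately show ?thesis unfolding d_def[symmetric] by linarith
qed

lemma RRBB_bound_symmetric: "a \<le> n \<Longrightarrow> RRBB_bound n (n - a) = RRBB_bound n a"
  by (simp add: RRBB_bound_def)

text \<open>As a function of \<open>t = (2a - n)\<^sup>2\<close> the bound is a concave parabola with vertex \<open>3n - 4\<close>.\<close>

lemma RRBB_bound_le_opt:
  assumes n: "n \<ge> 100000" and a: "a \<le> n" "n \<le> 2 * a"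
  shows "RRBB_bound n a < opt_bound n \<or>
    RRBB_bound n a \<le> opt_bound n \<and> a \<in> {opt_floor n, opt_ceiling n}"
proof -
  note o = opt_properties[OF n]
  have le: "opt_floor n \<le> n" using o by linarith
  consider "a < opt_floor n" | "a \<in> {opt_floor n, opt_ceiling n}" | "opt_ceiling n < a"
    using o(5,6) by fastforce
  then show ?thesis
  proof cases
    case 1
    have "(2 * int a - int n)\<^sup>2 < (2 * int (opt_floor n) - int n)\<^sup>2"
      using 1 a by (intro power_strict_mono) auto
    then have "((3 * int n - 4) - (2 * int (opt_floor n) - int n)\<^sup>2)\<^sup>2 < ((3 * int n - 4) - (2 * int a - int n)\<^sup>2)\<^sup>2"
      using o(2) by (intro power_strict_mono) auto
    then have "RRBB_bound n a < RRBB_bound n (opt_floor n)"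
      using RRBB_bound_eq[OF a(1)] RRBB_bound_eq[OF le] by (simp add: power2_commute[of "3 * int n - 4"])
    then show ?thesis by (simp add: opt_bound_def less_max_iff_disj)
  next
    case 2
    then show ?thesis by (auto simp: opt_bound_def)
  next
    case 3
    have "(2 * int (opt_ceiling n) - int n)\<^sup>2 < (2 * int a - int n)\<^sup>2"
      using 3 o(3) by (intro power_strict_mono) auto
    then have "((2 * int (opt_ceiling n) - int n)\<^sup>2 - (3 * int n - 4))\<^sup>2 < ((2 * int a - int n)\<^sup>2 - (3 * int n - 4))\<^sup>2"
      using o(4) by (intro power_strict_mono) auto
    then have "RRBB_bound n a < RRBB_bound n (opt_ceiling n)"
      using RRBB_bound_eq[OF a(1)] RRBB_bound_eq[OF o(7)] by simp
    then show ?thesis by (simp add: opt_bound_def less_max_iff_disj)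
  qed
qed

text \<open>Colourings of negative excess lie strictly below this value. The rounded-down size
  suffices: its distance from the vertex is at most half of 3n - 4.\<close>

lemma opt_bound_ge:
  assumes n: "n \<ge> 100000"
  shows "2 * int n * (int n - 1)\<^sup>2 * (int n - 4) \<le> 32 * int (opt_bound n)"
proof -
  note o = opt_properties[OF n]
  have le: "opt_floor n \<le> n" using o by linarith
  define N where "N = int n"
  define t where "t = (2 * int (opt_floor n) - int n)\<^sup>2"
  have "(2 * (3 * N - 4 - t))\<^sup>2 \<le> (3 * N - 4)\<^sup>2"
    using o(2) opt_floor_near[OF n] unfolding t_def N_def by (intro power_mono) auto
  then have "4 * (t - (3 * N - 4))\<^sup>2 \<le> (3 * N - 4)\<^sup>2" by (simp add: power2_eq_square algebra_simps)
  moreover have sq: "(3 * N - 4)\<^sup>2 = 9 * N\<^sup>2 - 24 * N + 16" by (simp add: power2_eq_square algebra_simps)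
  moreover have "N\<^sup>2 \<ge> 100000 * N" "N \<ge> 100000" using n by (simp_all add: N_def power2_eq_square)
  \<comment> \<open>The right-hand side is exactly the room between the vertex value and the
    colour-independent term.\<close>
  ultimately have g: "2 * (t - (3 * N - 4))\<^sup>2 \<le> 16 * N\<^sup>2 - 40 * N + 32" by linarith
  have "2 * N * (N - 1)\<^sup>2 * (N - 4) = 2 * N ^ 4 - 12 * N ^ 3 + 18 * N\<^sup>2 - 8 * N"
    by (simp add: power2_eq_square power3_eq_cube power4_eq_xxxx algebra_simps)
  also have "\<dots> \<le> 2 * (N ^ 4 - 6 * N ^ 3 + 8 * N\<^sup>2 + (3 * N - 4)\<^sup>2 - (t - (3 * N - 4))\<^sup>2)"
    using g unfolding sq by (simp add: right_diff_distrib)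
  also have "\<dots> = 32 * int (RRBB_bound n (opt_floor n))"
    unfolding N_def t_def RRBB_bound_eq[OF le, symmetric] by simp
  also have "\<dots> \<le> 32 * int (opt_bound n)" by (simp add: opt_bound_def)
  finally show ?thesis unfolding N_def .
qed

text \<open>The upper estimate drops the subtracted square; the lower one is the bound by the
  colour-independent term.\<close>

lemma opt_bound_asymptotic: "(\<lambda>n. real (opt_bound n) - (1/16) * real n ^ 4) \<in> O(\<lambda>n. real n ^ 3)"
proof (rule bigoI[where c = 2], rule eventually_sequentiallyI[of 100000])
  fix n :: nat assume n: "100000 \<le> n"
  note o = opt_properties[OF n]
  define N where "N = int n"
  have N: "N \<ge> 100000" using n by (simp add: N_def)
  have N2: "N\<^sup>2 \<le> N ^ 3" using N by (intro power_increasing) auto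
  have N1: "N \<le> N\<^sup>2" using N by (simp add: power2_eq_square)
  have le: "16 * int (RRBB_bound n a) - N ^ 4 \<le> 32 * N ^ 3" if "a \<le> n" for a
  proof -
    have "16 * int (RRBB_bound n a) \<le> N ^ 4 - 6 * N ^ 3 + 8 * N\<^sup>2 + (3 * N - 4)\<^sup>2"
      using RRBB_bound_eq[OF that] zero_le_power2[of "(2 * int a - int n)\<^sup>2 - (3 * int n - 4)"]
      unfolding N_def by linarith
    moreover have "(3 * N - 4)\<^sup>2 = 9 * N\<^sup>2 - 24 * N + 16" by (simp add: power2_eq_square algebra_simps)
    ultimately show ?thesis using N N1 N2 by linarith
  qed
  have "16 * int (opt_bound n) - N ^ 4 \<le> 32 * N ^ 3"
    using le[of "opt_floor n"] le[of "opt_ceiling n"] o unfolding opt_bound_def by (simp add: max_def)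
  moreover have "- 32 * N ^ 3 \<le> 16 * int (opt_bound n) - N ^ 4"
  proof -
    have "2 * N * (N - 1)\<^sup>2 * (N - 4) = 2 * N ^ 4 - 12 * N ^ 3 + 18 * N\<^sup>2 - 8 * N"
      by (simp add: power2_eq_square power3_eq_cube power4_eq_xxxx algebra_simps)
    then show ?thesis using opt_bound_ge[OF n] N N1 N2 unfolding N_def[symmetric] by linarith
  qed
  ultimately have "\<bar>16 * int (opt_bound n) - N ^ 4\<bar> \<le> 32 * N ^ 3" by linarith
  then have "real_of_int \<bar>16 * int (opt_bound n) - N ^ 4\<bar> \<le> real_of_int (32 * N ^ 3)"
    by (rule of_int_le_iff[THEN iffD2])
  then have "\<bar>16 * real (opt_bound n) - real n ^ 4\<bar> \<le> 32 * real n ^ 3"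
    by (simp add: N_def)
  then show "norm (real (opt_bound n) - (1/16) * real n ^ 4) \<le> 2 * norm (real n ^ 3)"
    by (simp add: abs_le_iff)
qed

lemma RRBB_cycles_le_opt_bound:
  assumes V: "finite V" and n: "card V \<ge> 100000"
  shows "card (RRBB_cycles V c) \<le> opt_bound (card V)"
    and "card (RRBB_cycles V c) = opt_bound (card V) \<Longrightarrow>
      \<exists>a\<in>{opt_floor (card V), opt_ceiling (card V)}. RRBB_bound (card V) a = opt_bound (card V) \<and>
        (\<exists>k. is_complete_bipartite V (colour_class V c k) a (card V - a))"
proof -
  let ?n = "card V" and ?N = "card (RRBB_cycles V c)"
  have "?N < opt_bound ?n \<or> ?N \<le> opt_bound ?n \<and>
      (?N = opt_bound ?n \<longrightarrow> (\<exists>a\<in>{opt_floor ?n, opt_ceiling ?n}. RRBB_bound ?n a = opt_bound ?n \<and>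
        (\<exists>k. is_complete_bipartite V (colour_class V c k) a (?n - a))))"
    using RRBB_cycles_le_some_bound[OF V n, of c]
  proof (elim disjE exE conjE)
    assume "32 * int ?N < 2 * int ?n * (int ?n - 1)\<^sup>2 * (int ?n - 4)"
    then show ?thesis using opt_bound_ge[OF n] by linarith
  next
    fix a assume a: "a \<le> ?n" "?N \<le> RRBB_bound ?n a"
      and eq: "?N = RRBB_bound ?n a \<longrightarrow> (\<exists>k. is_complete_bipartite V (colour_class V c k) a (?n - a))"
    \<comment> \<open>Exchanging the two parts allows the larger one to be listed first.\<close>
    obtain b where b: "b \<le> ?n" "?n \<le> 2 * b" "RRBB_bound ?n b = RRBB_bound ?n a"
      and eqb: "?N = RRBB_bound ?n b \<longrightarrow> (\<exists>k. is_complete_bipartite V (colour_class V c k) b (?n - b))"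
    proof (cases "?n \<le> 2 * a")
      case True
      then show thesis using that[of a] a eq by simp
    next
      case False
      have "\<exists>k. is_complete_bipartite V (colour_class V c k) (?n - a) (?n - (?n - a))"
        if "?N = RRBB_bound ?n (?n - a)"
        using eq that a RRBB_bound_symmetric[OF a(1)] is_complete_bipartite_commute by fastforce
      then show thesis using that[of "?n - a"] False RRBB_bound_symmetric[OF a(1)] by auto
    qed
    have "?N \<le> RRBB_bound ?n b" using a b by simp
    then show ?thesis
      using RRBB_bound_le_opt[OF n b(1,2)] eqb by fastforce
  qed
  then show "?N \<le> opt_bound ?n"
    and "?N = opt_bound ?n \<Longrightarrow> \<exists>a\<in>{opt_floor ?n, opt_ceiling ?n}. RRBB_bound ?n a = opt_bound ?n \<and>
        (\<exists>k. is_complete_bipartite V (colour_class V c k) a (?n - a))"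
    by auto
qed

theorem theorem1p7:
  "\<exists>n0::nat. \<exists>h::nat \<Rightarrow> real. h \<in> O(\<lambda>n. real n ^ 3) \<and>
    (\<forall>n\<ge>n0. \<exists>A::nat set. A \<noteq> {} \<and>
      A \<subseteq> {nat \<lfloor>(1/2) * (real n + sqrt (3 * real n - 4))\<rfloor>,
           nat \<lceil>(1/2) * (real n + sqrt (3 * real n - 4))\<rceil>} \<and>
      (\<forall>a\<in>A.
        real (RRBB_bound n a) = (1/16) * real n ^ 4 + h n \<and>
        (\<forall>(V::nat set) (c::nat set \<Rightarrow> colour). finite V \<and> card V = n \<longrightarrow>
          card (RRBB_cycles V c) \<le> RRBB_bound n a \<and>
          (card (RRBB_cycles V c) = RRBB_bound n a \<longleftrightarrow>
            (\<exists>a'\<in>A. \<exists>k. is_complete_bipartite V (colour_class V c k) a' (n - a'))))))"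
proof (intro exI[of _ 100000] exI[of _ "\<lambda>n. real (opt_bound n) - (1/16) * real n ^ 4"] conjI allI impI)
  show "(\<lambda>n. real (opt_bound n) - (1/16) * real n ^ 4) \<in> O(\<lambda>n. real n ^ 3)"
    by (rule opt_bound_asymptotic)
  fix n :: nat assume n: "100000 \<le> n"
  \<comment> \<open>All members of \<open>A\<close> share the value \<open>opt_bound n\<close>, so
    one error function serves them all and a colouring with any part size in \<open>A\<close> is
    extremal.\<close>
  define A where "A = {a \<in> {opt_floor n, opt_ceiling n}. RRBB_bound n a = opt_bound n}"
  show "\<exists>A::nat set. A \<noteq> {} \<and>
      A \<subseteq> {nat \<lfloor>(1/2) * (real n + sqrt (3 * real n - 4))\<rfloor>,
           nat \<lceil>(1/2) * (real n + sqrt (3 * real n - 4))\<rceil>} \<and>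
      (\<forall>a\<in>A.
        real (RRBB_bound n a) = (1/16) * real n ^ 4 + (real (opt_bound n) - (1/16) * real n ^ 4) \<and>
        (\<forall>(V::nat set) (c::nat set \<Rightarrow> colour). finite V \<and> card V = n \<longrightarrow>
          card (RRBB_cycles V c) \<le> RRBB_bound n a \<and>
          (card (RRBB_cycles V c) = RRBB_bound n a \<longleftrightarrow>
            (\<exists>a'\<in>A. \<exists>k. is_complete_bipartite V (colour_class V c k) a' (n - a')))))"
  proof (intro exI[of _ A] conjI ballI allI impI)
    show "A \<noteq> {}" by (auto simp: A_def opt_bound_def max_def)
    show "A \<subseteq> {nat \<lfloor>(1/2) * (real n + sqrt (3 * real n - 4))\<rfloor>,
           nat \<lceil>(1/2) * (real n + sqrt (3 * real n - 4))\<rceil>}"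
      by (auto simp: A_def opt_floor_def opt_ceiling_def)
    fix a assume a: "a \<in> A"
    then have ab: "RRBB_bound n a = opt_bound n" by (simp add: A_def)
    show "real (RRBB_bound n a) = (1/16) * real n ^ 4 + (real (opt_bound n) - (1/16) * real n ^ 4)"
      by (simp add: ab)
    fix V :: "nat set" and c :: "nat set \<Rightarrow> colour"
    assume "finite V \<and> card V = n"
    then have V: "finite V" and Vn: "card V = n" by auto
    show "card (RRBB_cycles V c) \<le> RRBB_bound n a"
      using RRBB_cycles_le_opt_bound(1)[OF V] n unfolding ab Vn by blast
    show "card (RRBB_cycles V c) = RRBB_bound n a \<longleftrightarrow>
        (\<exists>a'\<in>A. \<exists>k. is_complete_bipartite V (colour_class V c k) a' (n - a'))"
    proof
      assume "card (RRBB_cycles V c) = RRBB_bound n a"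
      then show "\<exists>a'\<in>A. \<exists>k. is_complete_bipartite V (colour_class V c k) a' (n - a')"
        using RRBB_cycles_le_opt_bound(2)[OF V, of c] n unfolding ab Vn A_def by blast
    next
      assume "\<exists>a'\<in>A. \<exists>k. is_complete_bipartite V (colour_class V c k) a' (n - a')"
      then obtain a' k where a': "a' \<in> A" "is_complete_bipartite V (colour_class V c k) a' (n - a')" by blast
      then have "card (RRBB_cycles V c) = RRBB_bound n a'"
        using card_RRBB_cycles_bipartite[OF V] Vn by blast
      then show "card (RRBB_cycles V c) = RRBB_bound n a" using a'(1) ab by (simp add: A_def)
    qed
  qed
qed

end
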